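(* Let $\varphi=(1+\sqrt5)/2$, let $S$ be the one-sided subshift on $\Sigma_+^A=\{\omega\in\{0,1\}^{\mathbb{N}}: (\omega_i,\omega_{i+1})\neq(1,1)\ \forall i\}$ with the Markov measure $\mu_+$ described in the context, let $V_S$ be its Perron-Frobenius operator on $L^2(\Sigma_+^A,\mu_+)$, and let $X$, $\Phi_{n,\pm}$, $\Phi_{n,\pm}'$, $U_S^\times$ be as defined in the context. Then: (1) The resolvent $(\lambda-V_S)^{-1}$ has an analytic continuation to the inside of the unit circle as an operator from $X$ into $X'$. The generalized eigenvalues with respect to the Gelfand triplet $X\subset L^2(\Sigma_+^A,\mu_+)\subset X'$ are given by $\{\varphi^{-n}\}_{n\ge0}\cup\{-\varphi^{-n-2}\}_{n\ge0}$. (2) $V_S$ and $U_S^\times$ have spectral decompositions of the form $$V_Sf=\sum_{n=0}^\infty\varphi^{-n}\,\overline{\langle\Phi_{n,+}'\,|\,f\rangle}\,\Phi_{n,+}-\sum_{n=0}^\infty\varphi^{-(n+2)}\,\overline{\langle\Phi_{n,-}'\,|\,f\rangle}\,\Phi_{n,-},\quad f\in X,$$ $$U_S^\times\mu=\sum_{n=0}^\infty\varphi^{-n}\,\langle\mu\,|\,\Phi_{n,+}\rangle\,\Phi_{n,+}'-\sum_{n=0}^\infty\varphi^{-(n+2)}\,\langle\mu\,|\,\Phi_{n,-}\rangle\,\Phi_{n,-}',\quad\mu\in X'.$$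
   Context: Setting: $\Sigma_+^A$ is the one-sided subshift of finite type with adjacency matrix $A=\begin{pmatrix}1&1\\1&0\end{pmatrix}$ (rows and columns indexed by $0,1$); $(S\omega)_j=\omega_{j+1}$. Cylinder sets: $C[i_1,\dots,i_r]=\{\omega\in\Sigma_+^A:\omega_k=i_k,\ k=1,\dots,r\}$. With $P=(p_{ij})_{i,j=0,1}=\begin{pmatrix}\varphi^{-1}&\varphi^{-2}\\1&0\end{pmatrix}$ and $\pi=(\pi_0,\pi_1)=\frac1{\varphi^2+1}(\varphi^2,1)$, the Markov measure is the $S$-invariant measure with $\mu_+(C[i_1,\dots,i_r])=\pi_{i_1}p_{i_1i_2}\cdots p_{i_{r-1}i_r}$. The Koopman operator on $L^2(\Sigma_+^A,\mu_+)$ is $(U_Sf)(\omega)=f(S\omega)$, and $V_S=U_S^*$. Inner products are linear in the first variable. Test space: $h(\omega)=\sum_{k\ge1}\omega_k\varphi^{-k}$; $W=\mathbb{C}\mathbf{1}_{C[0]}\oplus\mathbb{C}\mathbf{1}_{C[1]}$; $X_n=W\otimes\bigoplus_{i=0}^n\mathbb{C}h^i$, i.e. the finite-dimensional span of the functions $\mathbf 1_{C[j]}h^i$ ($j=0,1$, $0\le i\le n$) in $L^2(\Sigma_+^A,\mu_+)$; $X=\varinjlim X_n=W\otimes\mathbb{C}[h]$ with the inductive limit topology. $V_S$ maps $X_n$ to $X_n$ and is continuous on $X$. Duality: $X'$ is the space of continuous anti-linear functionals on $X$ with the weak* topology; $\mu(f)$ is written $\langle\mu|f\rangle$ (linear in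 $\mu$, anti-linear in $f$). $L^2(\Sigma_+^A,\mu_+)\subset X'$ via $g\mapsto(g,\cdot)$. Infinite series in $X'$ converge in the weak* topology. The eigenvalues of $V_S|_X$ are $\varphi^{-n}$ and $-\varphi^{-n-2}$ ($n\ge0$), each with one-dimensional eigenspace. $\Phi_{n,+}$ and $\Phi_{n,-}$ are fixed eigenvectors (unique up to scalar) of $V_S|_X$ for $\varphi^{-n}$ and $-\varphi^{-n-2}$ respectively, with $\Phi_{0,+}=1$; together they form a basis of $X$. $\{\Phi_{n,\pm}'\}\subset X'$ is the dual basis, $\langle\Phi_{i,p}'|\Phi_{j,q}\rangle=\delta_{(i,p),(j,q)}$, $i,j\ge0$, $p,q\in\{+,-\}$. $U_S^\times:X'\to X'$ is defined by $\langle U_S^\times\mu|f\rangle=\langle\mu|V_Sf\rangle$ for $f\in X$, $\mu\in X'$. Generalized spectrum: for $f\in X$ the map $\lambda\mapsto(\lambda-V_S)^{-1}f\in L^2(\Sigma_+^A,\mu_+)\subset X'$ is holomorphic for $|\lambda|>1$. The resolvent has an analytic continuation as an operator from $X$ into $X'$ if, for every $f\in X$, this $X'$-valued function continues analytically (weak* sense) from $|\lambda|>1$ across the unit circle to its inside, outside a set of singularities; the continuation $R_\lambda:X\to X'$ is the generalized resolvent, and the set of its singularities is the generalized spectrum. For an isolated singularity $\lambda_0$, the Riesz projection is $\Pi_{\lambda_0}f=\frac1{2\pi i}\oint_C R_zf\,dz$ ($C$ a positively oriented closed curve encircling $\lambda_0$ and no other singularity), an operator from $X$ into $X'$. Such a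 $\lambda_0$ is a generalized eigenvalue if it has associated eigenvectors in $X'$; the generalized eigenspace is the image of $\Pi_{\lambda_0}$ and its nonzero elements are the generalized eigenvectors. *)

theory Defs
  imports "HOL-Complex_Analysis.Complex_Analysis"
begin
definition golden :: real where
  "golden = (1 + sqrt 5) / 2"

text \<open>Sequences are indexed from 0, so \<open>\<omega> k\<close> is the letter usually written with index \<open>k + 1\<close>.\<close>

definition Sig :: "(nat \<Rightarrow> nat) set" where
  "Sig = {\<omega>. \<forall>k. \<omega> k \<in> {0, 1} \<and> (\<omega> k, \<omega> (Suc k)) \<noteq> (1, 1)}"

definition shift :: "(nat \<Rightarrow> nat) \<Rightarrow> (nat \<Rightarrow> nat)" where
  "shift \<omega> = (\<lambda>k. \<omega> (Suc k))"

definition Cyl :: "nat list \<Rightarrow> (nat \<Rightarrow> nat) set" where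
  "Cyl w = {\<omega> \<in> Sig. \<forall>k < length w. \<omega> k = w ! k}"

definition trans_prob :: "nat \<Rightarrow> nat \<Rightarrow> real" where
  "trans_prob i j =
     (if i = 0 then (if j = 0 then 1 / golden else 1 / golden ^ 2)
      else (if j = 0 then 1 else 0))"

definition stat_prob :: "nat \<Rightarrow> real" where
  "stat_prob i = (if i = 0 then golden ^ 2 else 1) / (golden ^ 2 + 1)"

definition word_weight :: "nat list \<Rightarrow> real" where
  "word_weight w = stat_prob (hd w) * (\<Prod>k < length w - 1. trans_prob (w ! k) (w ! Suc k))"

text \<open>The conditions determine \<open>M\<close> uniquely, so this describes the Markov measure.\<close>

definition golden_markov_measure :: "(nat \<Rightarrow> nat) measure \<Rightarrow> bool" where
  "golden_markov_measure M \<longleftrightarrow>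
     space M = Sig \<and>
     sets M = sigma_sets Sig (range Cyl) \<and>
     (\<forall>w. w \<noteq> [] \<longrightarrow> set w \<subseteq> {0, 1} \<longrightarrow> emeasure M (Cyl w) = ennreal (word_weight w)) \<and>
     distr M M shift = M"

text \<open>Elements of \<open>L\<^sup>2\<close> are represented by functions; equality in \<open>L\<^sup>2\<close> is
  equality almost everywhere.\<close>

type_synonym cfun = "(nat \<Rightarrow> nat) \<Rightarrow> complex"

definition L2 :: "(nat \<Rightarrow> nat) measure \<Rightarrow> cfun set" where
  "L2 M = {f \<in> borel_measurable M. integrable M (\<lambda>\<omega>. (cmod (f \<omega>))\<^sup>2)}"

definition L2_inner :: "(nat \<Rightarrow> nat) measure \<Rightarrow> cfun \<Rightarrow> cfun \<Rightarrow> complex" where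
  "L2_inner M f g = (LINT \<omega>|M. f \<omega> * cnj (g \<omega>))"

definition L2_norm :: "(nat \<Rightarrow> nat) measure \<Rightarrow> cfun \<Rightarrow> real" where
  "L2_norm M f = sqrt (LINT \<omega>|M. (cmod (f \<omega>))\<^sup>2)"

definition koopman :: "cfun \<Rightarrow> cfun" where
  "koopman f = (\<lambda>\<omega>. f (shift \<omega>))"

text \<open>The adjoint of the Koopman operator: \<open>perron_frobenius M g\<close> is a version of \<open>U\<^sup>* g\<close>,
  which is unique almost everywhere.\<close>

definition perron_frobenius :: "(nat \<Rightarrow> nat) measure \<Rightarrow> cfun \<Rightarrow> cfun" where
  "perron_frobenius M g =
     (SOME v. v \<in> L2 M \<and> (\<forall>f \<in> L2 M. L2_inner M (koopman f) g = L2_inner M f v))"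

text \<open>A version of \<open>(\<zeta> - V)\<^sup>-\<^sup>1 f\<close>; it is unique almost everywhere for \<open>1 < cmod \<zeta>\<close>.\<close>

definition L2_resolvent :: "(nat \<Rightarrow> nat) measure \<Rightarrow> complex \<Rightarrow> cfun \<Rightarrow> cfun" where
  "L2_resolvent M \<zeta> f =
     (SOME g. g \<in> L2 M \<and> (AE \<omega> in M. \<zeta> * g \<omega> - perron_frobenius M g \<omega> = f \<omega>))"

definition height :: "(nat \<Rightarrow> nat) \<Rightarrow> real" where
  "height \<omega> = (\<Sum>k. real (\<omega> k) / golden ^ Suc k)"

text \<open>Test functions are taken as the functions themselves, extended by 0 outside \<open>Sig\<close>. They are
  continuous on \<open>Sig\<close> and every nonempty cylinder has positive measure, so two of them which
  agree almost everywhere are equal, and the test space embeds into \<open>L\<^sup>2\<close>.\<close>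

definition test_fun :: "nat \<Rightarrow> nat \<Rightarrow> cfun" where
  "test_fun j i = (\<lambda>\<omega>. indicator (Cyl [j]) \<omega> * of_real (height \<omega>) ^ i)"

definition Xn :: "nat \<Rightarrow> cfun set" where
  "Xn n = {f. \<exists>c :: nat \<Rightarrow> nat \<Rightarrow> complex.
              f = (\<lambda>\<omega>. \<Sum>j\<in>{0, 1}. \<Sum>i\<le>n. c j i * test_fun j i \<omega>)}"

definition X :: "cfun set" where
  "X = (\<Union>n. Xn n)"

text \<open>The locally convex inductive limit topology: the finest locally convex topology on \<open>X\<close> for
  which all inclusions of the finite-dimensional \<open>Xn n\<close> (normed by \<open>L2_norm\<close>) are continuous.
  A base at 0 is given by the absolutely convex sets whose traces on all \<open>Xn n\<close> are
  neighbourhoods of 0.\<close>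

definition basic_nbhd :: "(nat \<Rightarrow> nat) measure \<Rightarrow> cfun set \<Rightarrow> bool" where
  "basic_nbhd M W \<longleftrightarrow>
     W \<subseteq> X \<and>
     (\<forall>f \<in> W. \<forall>g \<in> W. \<forall>a b :: complex. cmod a + cmod b \<le> 1 \<longrightarrow>
        (\<lambda>\<omega>. a * f \<omega> + b * g \<omega>) \<in> W) \<and>
     (\<forall>n. \<exists>e > 0. \<forall>f \<in> Xn n. L2_norm M f < e \<longrightarrow> f \<in> W)"

definition X_topology :: "(nat \<Rightarrow> nat) measure \<Rightarrow> cfun topology" where
  "X_topology M = topology (\<lambda>U. U \<subseteq> X \<and>
     (\<forall>f \<in> U. \<exists>W. basic_nbhd M W \<and> (\<forall>w \<in> W. (\<lambda>\<omega>. f \<omega> + w \<omega>) \<in> U)))"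

lemma openin_X_topology:
  "openin (X_topology M) U \<longleftrightarrow> U \<subseteq> X \<and>
     (\<forall>f \<in> U. \<exists>W. basic_nbhd M W \<and> (\<forall>w \<in> W. (\<lambda>\<omega>. f \<omega> + w \<omega>) \<in> U))"
proof -
  have Int: "basic_nbhd M (W \<inter> W')" if 1: "basic_nbhd M W" and 2: "basic_nbhd M W'" for W W'
  proof -
    have "\<exists>e > 0. \<forall>f \<in> Xn n. L2_norm M f < e \<longrightarrow> f \<in> W \<inter> W'" for n
    proof -
      obtain e where "e > 0" "\<forall>f \<in> Xn n. L2_norm M f < e \<longrightarrow> f \<in> W"
        using 1 unfolding basic_nbhd_def by blast
      moreover obtain e' where "e' > 0" "\<forall>f \<in> Xn n. L2_norm M f < e' \<longrightarrow> f \<in> W'"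
        using 2 unfolding basic_nbhd_def by blast
      ultimately show ?thesis
        by (intro exI[of _ "min e e'"]) auto
    qed
    then show ?thesis
      using 1 2 unfolding basic_nbhd_def by auto
  qed
  have "istopology (\<lambda>U. U \<subseteq> X \<and>
     (\<forall>f \<in> U. \<exists>W. basic_nbhd M W \<and> (\<forall>w \<in> W. (\<lambda>\<omega>. f \<omega> + w \<omega>) \<in> U)))"
    unfolding istopology_def
  proof (intro conjI allI impI ballI)
    fix S T f
    assume S: "S \<subseteq> X \<and> (\<forall>f \<in> S. \<exists>W. basic_nbhd M W \<and> (\<forall>w \<in> W. (\<lambda>\<omega>. f \<omega> + w \<omega>) \<in> S))"
      and T: "T \<subseteq> X \<and> (\<forall>f \<in> T. \<exists>W. basic_nbhd M W \<and> (\<forall>w \<in> W. (\<lambda>\<omega>. f \<omega> + w \<omega>) \<in> T))"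
      and f: "f \<in> S \<inter> T"
    obtain W where W: "basic_nbhd M W" "\<forall>w \<in> W. (\<lambda>\<omega>. f \<omega> + w \<omega>) \<in> S"
      using S f by blast
    obtain W' where W': "basic_nbhd M W'" "\<forall>w \<in> W'. (\<lambda>\<omega>. f \<omega> + w \<omega>) \<in> T"
      using T f by blast
    show "\<exists>W. basic_nbhd M W \<and> (\<forall>w \<in> W. (\<lambda>\<omega>. f \<omega> + w \<omega>) \<in> S \<inter> T)"
      using Int[OF W(1) W'(1)] W(2) W'(2) by (intro exI[of _ "W \<inter> W'"]) blast
  next
    fix K f
    assume K: "\<forall>S \<in> K. S \<subseteq> X \<and>
        (\<forall>f \<in> S. \<exists>W. basic_nbhd M W \<and> (\<forall>w \<in> W. (\<lambda>\<omega>. f \<omega> + w \<omega>) \<in> S))"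
      and f: "f \<in> \<Union>K"
    then obtain S where "S \<in> K" "f \<in> S"
      by blast
    with K obtain W where "basic_nbhd M W" "\<forall>w \<in> W. (\<lambda>\<omega>. f \<omega> + w \<omega>) \<in> S"
      by blast
    with \<open>S \<in> K\<close> show "\<exists>W. basic_nbhd M W \<and> (\<forall>w \<in> W. (\<lambda>\<omega>. f \<omega> + w \<omega>) \<in> \<Union>K)"
      by blast
  qed blast+
  then show ?thesis
    unfolding X_topology_def by (simp only: topology_inverse')
qed

text \<open>Functionals on \<open>X\<close> are normalised to be \<open>undefined\<close> outside \<open>X\<close> so that equality of
  elements of the dual is equality in the logic.\<close>

definition X_dual :: "(nat \<Rightarrow> nat) measure \<Rightarrow> (cfun \<Rightarrow> complex) set" where
  "X_dual M = {\<mu> \<in> extensional X.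
     (\<forall>f \<in> X. \<forall>g \<in> X. \<forall>a b :: complex.
        \<mu> (\<lambda>\<omega>. a * f \<omega> + b * g \<omega>) = cnj a * \<mu> f + cnj b * \<mu> g) \<and>
     continuous_map (X_topology M) euclidean \<mu>}"

definition X_dual_topology :: "(nat \<Rightarrow> nat) measure \<Rightarrow> (cfun \<Rightarrow> complex) topology" where
  "X_dual_topology M = subtopology (product_topology (\<lambda>_. euclidean) X) (X_dual M)"

definition L2_embed :: "(nat \<Rightarrow> nat) measure \<Rightarrow> cfun \<Rightarrow> (cfun \<Rightarrow> complex)" where
  "L2_embed M g = (\<lambda>f \<in> X. L2_inner M g f)"

text \<open>The restriction of the Perron-Frobenius operator to \<open>X\<close>, as a map from \<open>X\<close> to \<open>X\<close>:
  it picks the version of the image that belongs to \<open>X\<close>.\<close>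

definition pf_X :: "(nat \<Rightarrow> nat) measure \<Rightarrow> cfun \<Rightarrow> cfun" where
  "pf_X M f = (THE g. g \<in> X \<and> (AE \<omega> in M. g \<omega> = perron_frobenius M f \<omega>))"

definition koopman_dual ::
    "(nat \<Rightarrow> nat) measure \<Rightarrow> (cfun \<Rightarrow> complex) \<Rightarrow> (cfun \<Rightarrow> complex)" where
  "koopman_dual M \<mu> = (\<lambda>f \<in> X. \<mu> (pf_X M f))"

definition weakstar_holomorphic ::
    "(nat \<Rightarrow> nat) measure \<Rightarrow> (complex \<Rightarrow> cfun \<Rightarrow> (cfun \<Rightarrow> complex)) \<Rightarrow> complex set \<Rightarrow> bool" where
  "weakstar_holomorphic M R D \<longleftrightarrow>
     (\<forall>\<zeta> \<in> D. \<forall>f \<in> X. R \<zeta> f \<in> X_dual M) \<and>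
     (\<forall>f \<in> X. \<forall>g \<in> X. (\<lambda>\<zeta>. R \<zeta> f g) holomorphic_on D)"

text \<open>\<open>z\<close> is a removable point of \<open>Z\<close> if the whole operator-valued function, i.e. \<open>R \<zeta> f\<close> for all
  \<open>f\<close> on one common neighbourhood of \<open>z\<close>, extends analytically across \<open>z\<close>.\<close>

definition removable_at ::
    "(nat \<Rightarrow> nat) measure \<Rightarrow> complex set \<Rightarrow> (complex \<Rightarrow> cfun \<Rightarrow> (cfun \<Rightarrow> complex)) \<Rightarrow> complex \<Rightarrow> bool"
  where
  "removable_at M Z R z \<longleftrightarrow>
     (\<exists>r > 0. \<exists>Q. weakstar_holomorphic M Q (ball z r) \<and>
        (\<forall>\<zeta> \<in> ball z r - Z. \<forall>f \<in> X. Q \<zeta> f = R \<zeta> f))"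

text \<open>\<open>R\<close> is the generalized resolvent with set of singularities (generalized spectrum) \<open>Z\<close>: it
  continues the resolvent analytically from \<open>1 < cmod \<zeta>\<close> along the connected open set \<open>- Z\<close>,
  which is dense (so the continuation does reach the inside of the unit circle, up to the
  singularities), and every point of \<open>Z\<close> is a genuine singularity.\<close>

definition generalized_resolvent ::
    "(nat \<Rightarrow> nat) measure \<Rightarrow> complex set \<Rightarrow> (complex \<Rightarrow> cfun \<Rightarrow> (cfun \<Rightarrow> complex)) \<Rightarrow> bool" where
  "generalized_resolvent M Z R \<longleftrightarrow>
     Z \<subseteq> cball 0 1 \<and> closed Z \<and> interior Z = {} \<and> connected (- Z) \<and>
     weakstar_holomorphic M R (- Z) \<and>
     (\<forall>\<zeta> \<in> - Z. \<forall>f \<in> X. \<forall>g \<in> X. \<forall>a b :: complex. \<forall>x \<in> X.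
        R \<zeta> (\<lambda>\<omega>. a * f \<omega> + b * g \<omega>) x = a * R \<zeta> f x + b * R \<zeta> g x) \<and>
     (\<forall>\<zeta>. 1 < cmod \<zeta> \<longrightarrow> (\<forall>f \<in> X. R \<zeta> f = L2_embed M (L2_resolvent M \<zeta> f))) \<and>
     (\<forall>z \<in> Z. \<not> removable_at M Z R z)"

definition encircles :: "complex set \<Rightarrow> complex \<Rightarrow> (real \<Rightarrow> complex) \<Rightarrow> bool" where
  "encircles Z z0 \<gamma> \<longleftrightarrow>
     valid_path \<gamma> \<and> pathfinish \<gamma> = pathstart \<gamma> \<and> path_image \<gamma> \<subseteq> - Z \<and>
     winding_number \<gamma> z0 = 1 \<and> (\<forall>z \<in> Z - {z0}. winding_number \<gamma> z = 0)"

text \<open>The integral is taken in the weak* sense. For an isolated point \<open>z0\<close> of \<open>Z\<close> it does not depend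
  on the choice of the curve.\<close>

definition riesz_projection ::
    "complex set \<Rightarrow> (complex \<Rightarrow> cfun \<Rightarrow> (cfun \<Rightarrow> complex)) \<Rightarrow> complex \<Rightarrow> cfun \<Rightarrow> (cfun \<Rightarrow> complex)"
  where
  "riesz_projection Z R z0 f =
     (\<lambda>g \<in> X. 1 / (2 * of_real pi * \<i>) *
        contour_integral (SOME \<gamma>. encircles Z z0 \<gamma>) (\<lambda>z. R z f g))"

definition generalized_eigenspace ::
    "complex set \<Rightarrow> (complex \<Rightarrow> cfun \<Rightarrow> (cfun \<Rightarrow> complex)) \<Rightarrow> complex \<Rightarrow> (cfun \<Rightarrow> complex) set" where
  "generalized_eigenspace Z R z0 = riesz_projection Z R z0 ` X"

definition generalized_eigenvalue ::
    "complex set \<Rightarrow> (complex \<Rightarrow> cfun \<Rightarrow> (cfun \<Rightarrow> complex)) \<Rightarrow> complex \<Rightarrow> bool" where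
  "generalized_eigenvalue Z R z0 \<longleftrightarrow>
     z0 isolated_in Z \<and> (\<exists>\<mu> \<in> generalized_eigenspace Z R z0. \<mu> \<noteq> (\<lambda>f \<in> X. 0))"

datatype branch = Plus | Minus

definition eigval :: "branch \<Rightarrow> nat \<Rightarrow> complex" where
  "eigval p n = (case p of Plus \<Rightarrow> of_real (1 / golden ^ n)
                         | Minus \<Rightarrow> - of_real (1 / golden ^ (n + 2)))"

definition eigenvector_system ::
    "(nat \<Rightarrow> nat) measure \<Rightarrow> (branch \<Rightarrow> nat \<Rightarrow> cfun) \<Rightarrow> bool" where
  "eigenvector_system M \<Phi> \<longleftrightarrow>
     (\<forall>p n. \<Phi> p n \<in> X \<and> \<Phi> p n \<noteq> (\<lambda>_. 0) \<and>
        pf_X M (\<Phi> p n) = (\<lambda>\<omega>. eigval p n * \<Phi> p n \<omega>)) \<and>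
     \<Phi> Plus 0 = indicator Sig"

definition dual_system ::
    "(nat \<Rightarrow> nat) measure \<Rightarrow> (branch \<Rightarrow> nat \<Rightarrow> cfun) \<Rightarrow> (branch \<Rightarrow> nat \<Rightarrow> cfun \<Rightarrow> complex) \<Rightarrow> bool" where
  "dual_system M \<Phi> \<Phi>' \<longleftrightarrow>
     (\<forall>p i. \<Phi>' p i \<in> X_dual M) \<and>
     (\<forall>p q i j. \<Phi>' p i (\<Phi> q j) = (if (i, p) = (j, q) then 1 else 0))"

end

theory Submission
  imports Defs "HOL-Library.Function_Algebras"
begin

text \<open>The Perron-Frobenius operator averages over the preimages \<open>0\<omega>\<close> and \<open>1\<omega>\<close> with the backward
  transition probabilities. Since \<open>h(j\<omega>) = (j + h(\<omega>)) / \<phi>\<close>, it is block triangular for the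
  filtration of the test space by the degree in \<open>h\<close>, with diagonal blocks \<open>\<phi>\<^sup>-\<^sup>n P\<close>; the eigenvalues
  of \<open>P\<close> are \<open>1\<close> and \<open>-\<phi>\<^sup>-\<^sup>2\<close>. By a dimension count the eigenvectors of degree at most \<open>n\<close> span all
  test functions of degree at most \<open>n\<close>, so every test function has a finite eigenvector expansion, and
  the resolvent applied to it is a finite sum of simple poles at eigenvalues. This gives the
  continuation outside the eigenvalues and their accumulation point 0. An eigenvalue is a singularity
  because there the residue of the resolvent, applied to the eigenvector and tested on it, is the
  squared norm of the eigenvector. Any other generalized resolvent agrees with this one by the
  identity theorem, because removing a countable closed set leaves a plane domain connected.\<close>

section \<open>The transfer operator of the Markov measure\<close>

text \<open>Behind these steps lie three difficulties. Operators and resolvents are given as choices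
  among functions that agree almost everywhere, so each has to be pinned down before anything can be
  computed: the adjoint by the explicit \<open>transfer\<close>, the resolvent for modulus above 1
  by contractivity of \<open>transfer\<close> on \<open>L2\<close>, and the version inside
  \<open>X\<close> by full support of the measure together with continuity of test functions. Next,
  the given dual system does more than supply coefficients: biorthogonality yields the independence
  of the eigenvectors, and continuity of the \<open>\<Phi>'\<close> is the source of continuity for
  every functional constructed here, the resolvent values and the limits of the dual series
  included. Finally, for one fixed test function the continued resolvent is regular near 0, being a
  finite sum of poles at nonzero points. The point 0 is singular only because the radius of
  regularity shrinks as the degree grows, so that no neighbourhood of 0 serves all of
  \<open>X\<close>.\<close>

lemma golden_gt_1: "golden > 1"
  unfolding golden_def by (simp add: real_less_rsqrt)

lemma golden_sq: "golden\<^sup>2 = golden + 1"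
  unfolding golden_def by (simp add: power2_eq_square field_simps)

lemma golden_inverse: "1 / golden + 1 / golden\<^sup>2 = 1"
  using golden_gt_1 golden_sq by (simp add: field_simps power2_eq_square)

text \<open>Bayes' rule: the probability that the letter before \<open>i\<close> was
  \<open>j\<close>, i.e. the transition probability of the time-reversed chain. The chain satisfies
  detailed balance, so on the letters 0 and 1 this is \<open>trans_prob i j\<close> again, which is
  why the matrix P itself appears in the diagonal blocks.\<close>

definition back_prob :: "nat \<Rightarrow> nat \<Rightarrow> real" where
  "back_prob j i = stat_prob j * trans_prob j i / stat_prob i"

lemma stat_prob_pos: "stat_prob i > 0"
  unfolding stat_prob_def using golden_gt_1 by (simp add: add_pos_pos)

lemma back_prob_nonneg: "back_prob j i \<ge> 0"
  using stat_prob_pos[of i] stat_prob_pos[of j] golden_gt_1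
  unfolding back_prob_def trans_prob_def by simp

lemma back_prob_simps:
  "back_prob 0 0 = 1 / golden" "back_prob 0 (Suc 0) = 1"
  "back_prob (Suc 0) 0 = 1 / golden\<^sup>2" "back_prob (Suc 0) (Suc 0) = 0"
proof -
  have "golden\<^sup>2 + 1 \<noteq> 0" "golden \<noteq> 0"
    using golden_gt_1 by (simp_all add: golden_sq)
  then show "back_prob 0 0 = 1 / golden" "back_prob 0 (Suc 0) = 1"
    "back_prob (Suc 0) 0 = 1 / golden\<^sup>2" "back_prob (Suc 0) (Suc 0) = 0"
    unfolding back_prob_def stat_prob_def trans_prob_def by simp_all
qed

text \<open>The point \<open>1\<omega>\<close> is not admissible if \<open>\<omega>\<close> starts with 1; \<open>extend 1 \<omega>\<close> is then a junk value, of
  weight \<open>back_prob 1 1 = 0\<close>.\<close>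

definition extend :: "nat \<Rightarrow> (nat \<Rightarrow> nat) \<Rightarrow> (nat \<Rightarrow> nat)" where
  "extend j \<omega> = (if j = 1 \<and> \<omega> 0 = 1 then \<omega> else case_nat j \<omega>)"

text \<open>The value 0 outside \<open>Sig\<close> matches the convention for test functions, so
  that images of test functions are test functions as HOL functions and not merely almost
  everywhere.\<close>

definition transfer :: "cfun \<Rightarrow> cfun" where
  "transfer f \<omega> = (if \<omega> \<in> Sig
     then \<Sum>j\<in>{0, 1}. of_real (back_prob j (\<omega> 0)) * f (extend j \<omega>) else 0)"

section \<open>Cylinder sets and word weights\<close>

lemma Sig_letter: "\<omega> \<in> Sig \<Longrightarrow> \<omega> k = 0 \<or> \<omega> k = 1"
  unfolding Sig_def by auto

lemma extend_in_Sig: "\<omega> \<in> Sig \<Longrightarrow> j \<in> {0, 1} \<Longrightarrow> extend j \<omega> \<in> Sig"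
  unfolding Sig_def extend_def by (auto split: nat.splits)

lemma shift_in_Sig: "\<omega> \<in> Sig \<Longrightarrow> shift \<omega> \<in> Sig"
  unfolding Sig_def shift_def by auto

lemma shift_case_nat: "shift (case_nat j \<omega>) = \<omega>"
  unfolding shift_def by auto

lemma Cyl_Nil: "Cyl [] = Sig"
  unfolding Cyl_def by simp

lemma Cyl_subset_Sig: "Cyl w \<subseteq> Sig"
  unfolding Cyl_def by auto

lemma in_Cyl_Cons: "\<omega> \<in> Cyl (a # w) \<longleftrightarrow> \<omega> \<in> Sig \<and> \<omega> 0 = a \<and> shift \<omega> \<in> Cyl w"
  using shift_in_Sig[of \<omega>] unfolding Cyl_def by (auto simp: All_less_Suc2 shift_def)

lemma in_Cyl_map: "\<omega> \<in> Sig \<Longrightarrow> \<omega> \<in> Cyl (map \<omega> [0..<n])"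
  unfolding Cyl_def by simp

lemma Cyl_append1: "Cyl w = Cyl (w @ [0]) \<union> Cyl (w @ [1])"
  unfolding Cyl_def using Sig_letter by (auto simp: nth_append less_Suc_eq)

lemma Cyl_append1_disjoint: "Cyl (w @ [0]) \<inter> Cyl (w @ [1]) = {}"
  unfolding Cyl_def by auto

lemma Cyl_bad_letter: assumes "\<not> set w \<subseteq> {0, 1}" shows "Cyl w = {}"
proof -
  obtain a where "a \<in> set w" "a \<notin> {0, 1}"
    using assms by blast
  then obtain k where "k < length w" "w ! k \<notin> {0, 1}"
    unfolding in_set_conv_nth by blast
  then have "\<omega> \<notin> Cyl w" for \<omega>
    using Sig_letter[of \<omega> k] unfolding Cyl_def by auto
  then show ?thesis by blast
qed

lemma Cyl_Int_stable: "Int_stable (range Cyl)"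
proof -
  have *: "Cyl w \<inter> Cyl v \<in> range Cyl" if le: "length w \<le> length v" for w v
  proof (cases "\<forall>k < length w. w ! k = v ! k")
    case True
    then have "Cyl w \<inter> Cyl v = Cyl v"
      using le unfolding Cyl_def by fastforce
    then show ?thesis by blast
  next
    case False
    then have "Cyl w \<inter> Cyl v = {}"
      using le unfolding Cyl_def by fastforce
    \<comment> \<open>Cylinders of words with differing letters are disjoint; the empty intersection
      is itself a cylinder because words with illegal letters are allowed.\<close>
    moreover have "Cyl [2] = {}" by (rule Cyl_bad_letter) simp
    ultimately show ?thesis by (metis rangeI)
  qed
  show ?thesis
    unfolding Int_stable_def using * by (metis (no_types, lifting) Int_commute image_iff nle_le)
qed

text \<open>Replacing the initial factor \<open>stat_prob b\<close> by
  \<open>stat_prob j * trans_prob j b\<close> is multiplication by \<open>back_prob j b\<close>.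
  This is where the reversed probabilities enter the measure.\<close>

lemma word_weight_Cons_Cons:
  "word_weight (j # b # v) = back_prob j b * word_weight (b # v)"
proof -
  have "stat_prob b \<noteq> 0"
    using stat_prob_pos[of b] by simp
  then show ?thesis
    unfolding word_weight_def back_prob_def
    by (simp del: prod.lessThan_Suc add: prod.lessThan_Suc_shift[of _ "length v"])
qed

lemma trans_prob_nonneg: "trans_prob i j \<ge> 0"
  unfolding trans_prob_def using golden_gt_1 by simp

lemma word_weight_nonneg: "word_weight w \<ge> 0"
  unfolding word_weight_def
  by (intro mult_nonneg_nonneg prod_nonneg less_imp_le[OF stat_prob_pos] trans_prob_nonneg)

text \<open>Of two consecutive letters of an admissible sequence one is 0, so no transition has
  probability 0. This gives the measure full support.\<close>

lemma word_weight_pos: assumes "\<omega> \<in> Sig" shows "word_weight (map \<omega> [0..<n]) > 0"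
proof -
  have "trans_prob (\<omega> k) (\<omega> (Suc k)) > 0" for k
  proof -
    have "\<omega> k = 0 \<or> \<omega> (Suc k) = 0"
      using assms Sig_letter[OF assms, of k] Sig_letter[OF assms, of "Suc k"]
      unfolding Sig_def by (simp, metis)
    then show ?thesis
      using golden_gt_1 unfolding trans_prob_def by auto
  qed
  then show ?thesis
    unfolding word_weight_def
    by (intro mult_pos_pos prod_pos stat_prob_pos) simp
qed

section \<open>The Markov measure and integration over preimages\<close>

locale golden_markov =
  fixes M :: "(nat \<Rightarrow> nat) measure"
  assumes markov: "golden_markov_measure M"
begin

lemma space_M: "space M = Sig"
  and sets_M: "sets M = sigma_sets Sig (range Cyl)"
  and emeasure_Cyl: "w \<noteq> [] \<Longrightarrow> set w \<subseteq> {0, 1} \<Longrightarrow> emeasure M (Cyl w) = ennreal (word_weight w)"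
  and distr_shift: "distr M M shift = M"
  using markov unfolding golden_markov_measure_def by auto

lemma Cyl_sets[measurable]: "Cyl w \<in> sets M"
  unfolding sets_M by blast

lemma emeasure_Sig: "emeasure M Sig = 1"
proof -
  have "emeasure M Sig = emeasure M (Cyl [0]) + emeasure M (Cyl [1])"
    using plus_emeasure[of "Cyl [0]" M "Cyl [1]"] Cyl_append1[of "[]"] Cyl_append1_disjoint[of "[]"]
    by (simp add: Cyl_Nil)
  also have "\<dots> = ennreal (stat_prob 0 + stat_prob 1)"
    using less_imp_le[OF stat_prob_pos] by (simp add: emeasure_Cyl word_weight_def)
  also have "stat_prob 0 + stat_prob 1 = 1"
    using golden_gt_1 unfolding stat_prob_def by (simp add: golden_sq field_simps)
  finally show ?thesis by simp
qed

sublocale finite_measure M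
  by (rule finite_measureI) (simp add: space_M emeasure_Sig)

lemma letter_measurable[measurable]: "(\<lambda>\<omega>. \<omega> k) \<in> measurable M (count_space UNIV)"
proof (rule measurable_count_space_eq2_countable[THEN iffD2, rotated], safe)
  fix a
  have "(\<lambda>\<omega>. \<omega> k) -` {a} \<inter> space M = (\<Union>w\<in>{w. length w = Suc k \<and> w ! k = a}. Cyl w)"
  proof (intro equalityI subsetI)
    fix \<omega> assume "\<omega> \<in> (\<lambda>\<omega>. \<omega> k) -` {a} \<inter> space M"
    then have "\<omega> \<in> Cyl (map \<omega> [0..<Suc k])" "\<omega> k = a"
      by (auto simp: space_M intro!: in_Cyl_map simp del: upt_Suc)
    then show "\<omega> \<in> (\<Union>w\<in>{w. length w = Suc k \<and> w ! k = a}. Cyl w)"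
      by (intro UN_I[of "map \<omega> [0..<Suc k]"]) (auto simp del: upt_Suc)
  qed (auto simp: Cyl_def space_M)
  also have "\<dots> \<in> sets M"
    by (intro sets.countable_UN'' Cyl_sets) auto
  finally show "(\<lambda>\<omega>. \<omega> k) -` {a} \<inter> space M \<in> sets M" .
qed auto

text \<open>A cylinder constrains finitely many letters, and cylinders generate the sigma-algebra,
  so measurability may be checked letter by letter.\<close>

lemma measurable_into_M:
  assumes "\<And>\<omega>. \<omega> \<in> Sig \<Longrightarrow> g \<omega> \<in> Sig"
    and [measurable]: "\<And>k. (\<lambda>\<omega>. g \<omega> k) \<in> measurable M (count_space UNIV)"
  shows "g \<in> measurable M M"
proof (rule measurable_sigma_sets[OF sets_M])
  show "range Cyl \<subseteq> Pow Sig" using Cyl_subset_Sig by blast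
  show "g \<in> space M \<rightarrow> Sig" using assms(1) by (auto simp: space_M)
  fix A assume "A \<in> range Cyl"
  then obtain w where A: "A = Cyl w" by blast
  have "g -` A \<inter> space M = {\<omega> \<in> space M. \<forall>k < length w. g \<omega> k = w ! k}"
    unfolding A Cyl_def using assms(1) by (auto simp: space_M)
  also have "\<dots> \<in> sets M" by measurable
  finally show "g -` A \<inter> space M \<in> sets M" .
qed

lemma shift_measurable[measurable]: "shift \<in> measurable M M"
  by (rule measurable_into_M) (auto simp: shift_in_Sig, simp add: shift_def)

lemma extend_measurable[measurable]:
  assumes "j \<in> {0, 1}" shows "extend j \<in> measurable M M"
proof (rule measurable_into_M)
  show "extend j \<omega> \<in> Sig" if "\<omega> \<in> Sig" for \<omega> using extend_in_Sig that assms .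
  show "(\<lambda>\<omega>. extend j \<omega> k) \<in> measurable M (count_space UNIV)" for k
    by (cases k) (simp_all add: extend_def if_distrib[of "\<lambda>x. x _"] cong: if_cong)
qed

lemma back_prob_measurable[measurable]: "(\<lambda>\<omega>. back_prob j (\<omega> k)) \<in> borel_measurable M"
  by (rule measurable_compose[OF letter_measurable]) simp

text \<open>Each cylinder is the disjoint union of its two one-letter prolongations, so agreement on
  longer words passes down to words of length 1 and 0. Starting at length 2 leaves, after removal of
  the first letter, a nonempty word to which \<open>emeasure_Cyl\<close> and
  \<open>word_weight_Cons_Cons\<close> apply.\<close>

lemma finite_measure_eqI_Cyl:
  assumes "sets N = sets M" "finite_measure N" "sets N' = sets M"
    and long: "\<And>w. length w \<ge> 2 \<Longrightarrow> emeasure N (Cyl w) = emeasure N' (Cyl w)"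
  shows "N = N'"
proof -
  have split: "emeasure K (Cyl w) = emeasure K (Cyl (w @ [0])) + emeasure K (Cyl (w @ [1]))"
    if "sets K = sets M" for K w
    by (subst Cyl_append1, rule plus_emeasure[symmetric])
       (use Cyl_append1_disjoint that Cyl_sets in auto)
  have one: "emeasure N (Cyl w) = emeasure N' (Cyl w)" if "length w \<ge> 1" for w
    using that by (simp add: split[OF assms(1), of w] split[OF assms(3), of w] long)
  have all: "emeasure N (Cyl w) = emeasure N' (Cyl w)" for w
    by (simp add: split[OF assms(1), of w] split[OF assms(3), of w] one)
  show ?thesis
  proof (rule measure_eqI_generator_eq[OF Cyl_Int_stable, of Sig _ _ "\<lambda>_. Sig"])
    show "range Cyl \<subseteq> Pow Sig" using Cyl_subset_Sig by blast
    show "emeasure N Sig \<noteq> \<infinity>" 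
      using assms(2) by (simp add: finite_measure.emeasure_finite)
    show "range (\<lambda>_::nat. Sig) \<subseteq> range Cyl" using Cyl_Nil by (metis image_subsetI rangeI)
  qed (use all assms sets_M in auto)
qed

text \<open>This change of variables identifies \<open>transfer\<close> as the adjoint of the Koopman operator.\<close>

lemma density_Cyl_eq_distr_extend:
  assumes j: "j \<in> {0, 1}"
  shows "density M (\<lambda>\<omega>. ennreal (indicator (Cyl [j]) \<omega>)) =
    distr (density M (\<lambda>\<omega>. ennreal (back_prob j (\<omega> 0)))) M (extend j)" (is "?N = ?N'")
proof (rule finite_measure_eqI_Cyl)
  note [measurable] = extend_measurable[OF j]
  show "finite_measure ?N"
    by (rule finite_measureI) (simp add: emeasure_density ennreal_indicator cong: nn_integral_cong)
  fix w :: "nat list" assume "length w \<ge> 2"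
  then obtain a b v where w: "w = a # b # v"
    by (metis One_nat_def Suc_1 Suc_le_length_iff)
  have N: "emeasure ?N (Cyl w) = emeasure M (Cyl w \<inter> Cyl [j])"
    by (simp add: emeasure_density ennreal_indicator indicator_inter_arith[symmetric] Int_commute)
  have sub: "extend j -` Cyl w \<inter> space M \<in> sets M" by measurable
  have N': "emeasure ?N' (Cyl w) =
      (\<integral>\<^sup>+\<omega>. ennreal (back_prob j (\<omega> 0)) * indicator (extend j -` Cyl w \<inter> space M) \<omega> \<partial>M)"
    using sub by (simp add: emeasure_distr emeasure_density)
  \<comment> \<open>At the junk value of \<open>extend\<close> both sides vanish: the left because
    \<open>back_prob 1 1 = 0\<close>, the right because the indicator forces \<open>b = 1\<close>
    and the same weight appears.\<close>
  have pt: "ennreal (back_prob j (\<omega> 0)) * indicator (extend j -` Cyl w \<inter> space M) \<omega> =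
      (if a = j then ennreal (back_prob j b) * indicator (Cyl (b # v)) \<omega> else 0)"
    if "\<omega> \<in> Sig" for \<omega>
  proof (cases "j = 1 \<and> \<omega> 0 = 1")
    case True
    then show ?thesis
      by (auto simp: back_prob_simps indicator_def in_Cyl_Cons)
  next
    case False
    then have "extend j \<omega> = case_nat j \<omega>" "case_nat j \<omega> \<in> Sig"
      using extend_in_Sig[OF that j] by (auto simp: extend_def)
    then show ?thesis
      using that by (auto simp: w indicator_def in_Cyl_Cons shift_case_nat space_M)
  qed
  show "emeasure ?N (Cyl w) = emeasure ?N' (Cyl w)"
  proof (cases "a = j")
    case True
    have "emeasure ?N' (Cyl w) = ennreal (back_prob j b) * emeasure M (Cyl (b # v))"
      unfolding N' using True
      by (subst nn_integral_cong[OF pt]) (auto simp: space_M nn_integral_cmult)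
    also have "\<dots> = emeasure M (Cyl w)"
    proof (cases "set (b # v) \<subseteq> {0, 1}")
      case letters: True
      then show ?thesis
        using True j
        by (simp add: w emeasure_Cyl word_weight_Cons_Cons ennreal_mult back_prob_nonneg
            word_weight_nonneg)
    next
      case False
      then have "Cyl (b # v) = {}" "Cyl w = {}"
        unfolding w by (intro Cyl_bad_letter; auto)+
      then show ?thesis by simp
    qed
    finally have "emeasure ?N' (Cyl w) = emeasure M (Cyl w)" .
    moreover have "Cyl w \<inter> Cyl [j] = Cyl w"
      using True unfolding w by (auto simp: in_Cyl_Cons Cyl_Nil shift_in_Sig)
    ultimately show ?thesis using N by simp
  next
    case False
    then have "Cyl w \<inter> Cyl [j] = {}"
      unfolding w by (auto simp: in_Cyl_Cons)
    then have "emeasure ?N (Cyl w) = 0" using N by simp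
    moreover have "emeasure ?N' (Cyl w) = 0"
      unfolding N' using False by (subst nn_integral_cong[OF pt]) (auto simp: space_M)
    ultimately show ?thesis by simp
  qed
qed simp_all

lemma
  fixes F :: "(nat \<Rightarrow> nat) \<Rightarrow> 'b :: {banach, second_countable_topology}"
  assumes j: "j \<in> {0, 1}" and F[measurable]: "F \<in> borel_measurable M"
  shows integrable_extend: "integrable M (\<lambda>\<omega>. back_prob j (\<omega> 0) *\<^sub>R F (extend j \<omega>)) \<longleftrightarrow>
      integrable M (\<lambda>\<omega>. indicator (Cyl [j]) \<omega> *\<^sub>R F \<omega>)"
    and integral_extend: "(LINT \<omega>|M. back_prob j (\<omega> 0) *\<^sub>R F (extend j \<omega>)) =
      (LINT \<omega>|M. indicator (Cyl [j]) \<omega> *\<^sub>R F \<omega>)"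
proof -
  note [measurable] = extend_measurable[OF j]
  let ?N = "density M (\<lambda>\<omega>. ennreal (indicator (Cyl [j]) \<omega>))"
  let ?D = "density M (\<lambda>\<omega>. ennreal (back_prob j (\<omega> 0)))"
  show "integrable M (\<lambda>\<omega>. back_prob j (\<omega> 0) *\<^sub>R F (extend j \<omega>)) \<longleftrightarrow>
      integrable M (\<lambda>\<omega>. indicator (Cyl [j]) \<omega> *\<^sub>R F \<omega>)"
  proof -
    have "integrable M (\<lambda>\<omega>. indicator (Cyl [j]) \<omega> *\<^sub>R F \<omega>) \<longleftrightarrow> integrable ?N F"
      by (subst integrable_density) auto
    also have "\<dots> \<longleftrightarrow> integrable ?D (\<lambda>\<omega>. F (extend j \<omega>))"
      unfolding density_Cyl_eq_distr_extend[OF j] by (subst integrable_distr_eq) auto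
    also have "\<dots> \<longleftrightarrow> integrable M (\<lambda>\<omega>. back_prob j (\<omega> 0) *\<^sub>R F (extend j \<omega>))"
      by (subst integrable_density) (auto simp: back_prob_nonneg)
    finally show ?thesis by simp
  qed
  have "(LINT \<omega>|M. indicator (Cyl [j]) \<omega> *\<^sub>R F \<omega>) = (LINT \<omega>|?N. F \<omega>)"
    by (subst integral_density) auto
  also have "\<dots> = (LINT \<omega>|?D. F (extend j \<omega>))"
    unfolding density_Cyl_eq_distr_extend[OF j] by (subst integral_distr) auto
  also have "\<dots> = (LINT \<omega>|M. back_prob j (\<omega> 0) *\<^sub>R F (extend j \<omega>))"
    by (subst integral_density) (auto simp: back_prob_nonneg)
  finally show "(LINT \<omega>|M. back_prob j (\<omega> 0) *\<^sub>R F (extend j \<omega>)) =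
      (LINT \<omega>|M. indicator (Cyl [j]) \<omega> *\<^sub>R F \<omega>)" by simp
qed

text \<open>The cylinders of the letters 0 and 1 partition \<open>Sig\<close>, so summing
  \<open>integral_extend\<close> over both recovers the whole integral: averaging over preimages
  preserves integrals. The value type is general because the real integrand
  \<open>(cmod (f \<omega>))\<^sup>2\<close> and complex products are both needed.\<close>

lemma
  fixes F :: "(nat \<Rightarrow> nat) \<Rightarrow> 'b :: {banach, second_countable_topology}"
  assumes F: "integrable M F"
  shows integrable_sum_extend: "integrable M (\<lambda>\<omega>. \<Sum>j\<in>{0, 1}. back_prob j (\<omega> 0) *\<^sub>R F (extend j \<omega>))"
    and integral_sum_extend:
      "(LINT \<omega>|M. (\<Sum>j\<in>{0, 1}. back_prob j (\<omega> 0) *\<^sub>R F (extend j \<omega>))) = (LINT \<omega>|M. F \<omega>)"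
proof -
  have meas: "F \<in> borel_measurable M" using F by auto
  have ind: "integrable M (\<lambda>\<omega>. indicator (Cyl [j]) \<omega> *\<^sub>R F \<omega>)" for j
    using F Cyl_sets integrable_mult_indicator by blast
  have int: "integrable M (\<lambda>\<omega>. back_prob j (\<omega> 0) *\<^sub>R F (extend j \<omega>))" if "j \<in> {0, 1}" for j
    using integrable_extend[OF that meas] ind by blast
  show "integrable M (\<lambda>\<omega>. \<Sum>j\<in>{0, 1}. back_prob j (\<omega> 0) *\<^sub>R F (extend j \<omega>))"
    using int by (intro Bochner_Integration.integrable_sum) auto
  have "(LINT \<omega>|M. (\<Sum>j\<in>{0, 1}. back_prob j (\<omega> 0) *\<^sub>R F (extend j \<omega>))) =
      (\<Sum>j\<in>{0, 1}. LINT \<omega>|M. back_prob j (\<omega> 0) *\<^sub>R F (extend j \<omega>))"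
    using int by (intro Bochner_Integration.integral_sum) auto
  also have "\<dots> = (\<Sum>j\<in>{0, 1}. LINT \<omega>|M. indicator (Cyl [j]) \<omega> *\<^sub>R F \<omega>)"
    using meas by (intro sum.cong refl integral_extend) auto
  also have "\<dots> = (LINT \<omega>|M. (\<Sum>j\<in>{0, 1}. indicator (Cyl [j]) \<omega> *\<^sub>R F \<omega>))"
    using ind by (intro Bochner_Integration.integral_sum[symmetric]) auto
  also have "\<dots> = (LINT \<omega>|M. F \<omega>)"
    using Sig_letter
    by (intro Bochner_Integration.integral_cong refl)
       (force simp: space_M indicator_def in_Cyl_Cons Cyl_Nil shift_in_Sig)
  finally show "(LINT \<omega>|M. (\<Sum>j\<in>{0, 1}. back_prob j (\<omega> 0) *\<^sub>R F (extend j \<omega>))) = (LINT \<omega>|M. F \<omega>)" .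
qed

end

section \<open>Convexity and inner products in the space of square-integrable functions\<close>

lemma back_prob_sum: "\<omega> \<in> Sig \<Longrightarrow> (\<Sum>j\<in>{0, 1}. back_prob j (\<omega> 0)) = 1"
  using Sig_letter[of \<omega> 0] golden_inverse by (auto simp: back_prob_simps)

text \<open>Jensen's inequality for the square, with the explicit deficit
  \<open>p * q * (cmod z - cmod w)\<^sup>2\<close>; the weights will be the two values of
  \<open>back_prob\<close>.\<close>

lemma norm_convex_combination_sq:
  fixes z w :: complex
  assumes "p \<ge> 0" "q \<ge> 0" "p + q = 1"
  shows "(cmod (of_real p * z + of_real q * w))\<^sup>2 \<le> p * (cmod z)\<^sup>2 + q * (cmod w)\<^sup>2"
proof -
  have "cmod (of_real p * z + of_real q * w) \<le> p * cmod z + q * cmod w"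
    using norm_triangle_ineq[of "of_real p * z" "of_real q * w"] assms by (simp add: norm_mult)
  then have "(cmod (of_real p * z + of_real q * w))\<^sup>2 \<le> (p * cmod z + q * cmod w)\<^sup>2"
    by (intro power_mono) auto
  also have "\<dots> = p * (cmod z)\<^sup>2 + q * (cmod w)\<^sup>2 - p * q * (cmod z - cmod w)\<^sup>2"
  proof -
    have q: "q = 1 - p" using assms by simp
    show ?thesis unfolding q by (simp add: power2_eq_square algebra_simps)
  qed
  also have "\<dots> \<le> p * (cmod z)\<^sup>2 + q * (cmod w)\<^sup>2"
    using assms by simp
  finally show ?thesis .
qed

lemma transfer_add: "transfer (\<lambda>\<omega>. f \<omega> + g \<omega>) \<omega> = transfer f \<omega> + transfer g \<omega>"
  by (simp add: transfer_def algebra_simps)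

lemma transfer_scale: "transfer (\<lambda>\<omega>. c * f \<omega>) \<omega> = c * transfer f \<omega>"
  by (simp add: transfer_def algebra_simps)

lemma L2_measurable: "f \<in> L2 M \<Longrightarrow> f \<in> borel_measurable M"
  unfolding L2_def by auto

lemma L2_square_integrable: "f \<in> L2 M \<Longrightarrow> integrable M (\<lambda>\<omega>. (cmod (f \<omega>))\<^sup>2)"
  unfolding L2_def by auto

lemma L2_scale: assumes "f \<in> L2 M" shows "(\<lambda>\<omega>. c * f \<omega>) \<in> L2 M"
  using assms unfolding L2_def by (auto simp: norm_mult power_mult_distrib)

lemma L2_add: assumes "f \<in> L2 M" "g \<in> L2 M" shows "(\<lambda>\<omega>. f \<omega> + g \<omega>) \<in> L2 M"
proof -
  note [measurable] = L2_measurable[OF assms(1)] L2_measurable[OF assms(2)]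
  have "integrable M (\<lambda>\<omega>. (cmod (f \<omega> + g \<omega>))\<^sup>2)"
  proof (rule Bochner_Integration.integrable_bound)
    show "integrable M (\<lambda>\<omega>. 2 * ((cmod (f \<omega>))\<^sup>2 + (cmod (g \<omega>))\<^sup>2))"
      using assms by (intro integrable_mult_right Bochner_Integration.integrable_add L2_square_integrable)
    have "(cmod (z + w))\<^sup>2 \<le> 2 * ((cmod z)\<^sup>2 + (cmod w)\<^sup>2)" for z w :: complex
    proof -
      have "(cmod (z + w))\<^sup>2 \<le> (cmod z + cmod w)\<^sup>2"
        by (intro power_mono norm_triangle_ineq) auto
      also have "\<dots> \<le> 2 * ((cmod z)\<^sup>2 + (cmod w)\<^sup>2)"
        using zero_le_power2[of "cmod z - cmod w"] by (simp add: power2_eq_square algebra_simps)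
      finally show ?thesis .
    qed
    then show "AE \<omega> in M. norm ((cmod (f \<omega> + g \<omega>))\<^sup>2) \<le> norm (2 * ((cmod (f \<omega>))\<^sup>2 + (cmod (g \<omega>))\<^sup>2))"
      by simp
  qed measurable
  then show ?thesis unfolding L2_def by simp
qed

lemma L2_diff: assumes "f \<in> L2 M" "g \<in> L2 M" shows "(\<lambda>\<omega>. f \<omega> - g \<omega>) \<in> L2 M"
  using L2_add[OF assms(1) L2_scale[OF assms(2), of "-1"]] by simp

lemma L2_product_integrable:
  assumes "f \<in> L2 M" "g \<in> L2 M" shows "integrable M (\<lambda>\<omega>. f \<omega> * cnj (g \<omega>))"
proof (rule Bochner_Integration.integrable_bound)
  note [measurable] = L2_measurable[OF assms(1)] L2_measurable[OF assms(2)]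
  have [measurable]: "cnj \<in> borel_measurable borel"
    by (intro borel_measurable_continuous_onI continuous_intros)
  show "integrable M (\<lambda>\<omega>. (cmod (f \<omega>))\<^sup>2 + (cmod (g \<omega>))\<^sup>2)"
    using assms by (intro Bochner_Integration.integrable_add L2_square_integrable)
  have "cmod z * cmod w \<le> (cmod z)\<^sup>2 + (cmod w)\<^sup>2" for z w :: complex
  proof -
    have "2 * (cmod z * cmod w) \<le> (cmod z)\<^sup>2 + (cmod w)\<^sup>2"
      using sum_squares_bound[of "cmod z" "cmod w"] by (simp add: mult.assoc)
    moreover have "0 \<le> cmod z * cmod w" by simp
    ultimately show ?thesis by linarith
  qed
  then show "AE \<omega> in M. norm (f \<omega> * cnj (g \<omega>)) \<le> norm ((cmod (f \<omega>))\<^sup>2 + (cmod (g \<omega>))\<^sup>2)"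
    by (simp add: norm_mult)
  show "(\<lambda>\<omega>. f \<omega> * cnj (g \<omega>)) \<in> borel_measurable M" by measurable
qed

lemma L2_inner_self: "L2_inner M f f = of_real (LINT \<omega>|M. (cmod (f \<omega>))\<^sup>2)"
  unfolding L2_inner_def by (simp add: complex_norm_square[symmetric] flip: integral_complex_of_real)

lemma L2_self_integral_eq_0:
  assumes "f \<in> L2 M" "(LINT \<omega>|M. (cmod (f \<omega>))\<^sup>2) = 0"
  shows "AE \<omega> in M. f \<omega> = 0"
  using integral_nonneg_eq_0_iff_AE[OF L2_square_integrable[OF assms(1)]] assms(2) by simp

lemma L2_inner_combination_left:
  assumes "f \<in> L2 M" "g \<in> L2 M" "h \<in> L2 M"
  shows "L2_inner M (\<lambda>\<omega>. a * f \<omega> + b * g \<omega>) h = a * L2_inner M f h + b * L2_inner M g h"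
proof -
  have "(\<lambda>\<omega>. (a * f \<omega> + b * g \<omega>) * cnj (h \<omega>)) =
      (\<lambda>\<omega>. a * (f \<omega> * cnj (h \<omega>)) + b * (g \<omega> * cnj (h \<omega>)))"
    by (auto simp: algebra_simps)
  then show ?thesis
    using L2_product_integrable[OF assms(1,3)] L2_product_integrable[OF assms(2,3)]
    unfolding L2_inner_def by simp
qed

lemma L2_inner_cnj: "L2_inner M f g = cnj (L2_inner M g f)"
  unfolding L2_inner_def by (subst Bochner_Integration.integral_cnj[symmetric]) (simp add: mult.commute del: Bochner_Integration.integral_cnj)

lemma L2_inner_combination_right:
  assumes "f \<in> L2 M" "g \<in> L2 M" "h \<in> L2 M"
  shows "L2_inner M h (\<lambda>\<omega>. a * f \<omega> + b * g \<omega>) = cnj a * L2_inner M h f + cnj b * L2_inner M h g"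
proof -
  have "L2_inner M h (\<lambda>\<omega>. a * f \<omega> + b * g \<omega>) = cnj (a * L2_inner M f h + b * L2_inner M g h)"
    by (subst L2_inner_cnj) (simp add: L2_inner_combination_left[OF assms])
  also have "\<dots> = cnj a * L2_inner M h f + cnj b * L2_inner M h g"
    by (simp flip: L2_inner_cnj)
  finally show ?thesis .
qed

lemma L2_inner_cong_AE:
  assumes "f \<in> L2 M" "g \<in> L2 M" "h \<in> L2 M" "AE \<omega> in M. f \<omega> = g \<omega>"
  shows "L2_inner M f h = L2_inner M g h"
  unfolding L2_inner_def
proof (rule integral_cong_AE)
  show "(\<lambda>\<omega>. f \<omega> * cnj (h \<omega>)) \<in> borel_measurable M" "(\<lambda>\<omega>. g \<omega> * cnj (h \<omega>)) \<in> borel_measurable M"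
    by (intro borel_measurable_integrable L2_product_integrable assms)+
  show "AE \<omega> in M. f \<omega> * cnj (h \<omega>) = g \<omega> * cnj (h \<omega>)" using assms(4) by auto
qed

lemma L2_AE_eqI:
  assumes v: "v \<in> L2 M" "v' \<in> L2 M" and eq: "\<And>f. f \<in> L2 M \<Longrightarrow> L2_inner M f v = L2_inner M f v'"
  shows "AE \<omega> in M. v \<omega> = v' \<omega>"
proof -
  define d where "d = (\<lambda>\<omega>. 1 * v \<omega> + (-1) * v' \<omega>)"
  have d: "d \<in> L2 M" using L2_diff[OF v] unfolding d_def by simp
  have "L2_inner M d d = 1 * L2_inner M d v - 1 * L2_inner M d v'"
    using L2_inner_combination_right[OF v d, of 1 "-1"] unfolding d_def by simp
  then have "L2_inner M d d = 0"
    using eq[OF d] by simp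
  then have "AE \<omega> in M. d \<omega> = 0"
    using L2_self_integral_eq_0[OF d] unfolding L2_inner_self by simp
  then show ?thesis unfolding d_def by auto
qed

section \<open>\<open>transfer\<close> as the Perron-Frobenius operator; uniqueness of the
  resolvent\<close>

context golden_markov
begin

lemma transfer_measurable[measurable]:
  assumes [measurable]: "f \<in> borel_measurable M" shows "transfer f \<in> borel_measurable M"
proof -
  have [measurable]: "extend 0 \<in> measurable M M" "extend 1 \<in> measurable M M" by simp_all
  have "(\<lambda>\<omega>. \<Sum>j\<in>{0, 1}. of_real (back_prob j (\<omega> 0)) * f (extend j \<omega>)) \<in> borel_measurable M"
    by simp
  then show ?thesis
    by (rule measurable_cong[THEN iffD1, rotated]) (simp add: transfer_def space_M)
qed

text \<open>The two weights \<open>back_prob j (\<omega> 0)\<close> sum to 1, so convexity bounds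
  the squared modulus pointwise by the preimage average of
  \<open>(cmod (f \<omega>))\<^sup>2\<close>, whose integral is that of
  \<open>(cmod (f \<omega>))\<^sup>2\<close>.\<close>

lemma
  assumes f: "f \<in> L2 M"
  shows transfer_L2: "transfer f \<in> L2 M"
    and transfer_contraction: "(LINT \<omega>|M. (cmod (transfer f \<omega>))\<^sup>2) \<le> (LINT \<omega>|M. (cmod (f \<omega>))\<^sup>2)"
proof -
  note [measurable] = L2_measurable[OF f]
  let ?B = "\<lambda>\<omega>. \<Sum>j\<in>{0, 1}. back_prob j (\<omega> 0) *\<^sub>R (cmod (f (extend j \<omega>)))\<^sup>2"
  note B = integrable_sum_extend[OF L2_square_integrable[OF f]]
  have le: "(cmod (transfer f \<omega>))\<^sup>2 \<le> ?B \<omega>" if "\<omega> \<in> Sig" for \<omega>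
    using norm_convex_combination_sq[OF back_prob_nonneg back_prob_nonneg, of 0 "\<omega> 0" 1 "\<omega> 0"]
      back_prob_sum[OF that] that
    by (simp add: transfer_def)
  have int: "integrable M (\<lambda>\<omega>. (cmod (transfer f \<omega>))\<^sup>2)"
  proof (rule Bochner_Integration.integrable_bound[OF B])
    show "AE \<omega> in M. norm ((cmod (transfer f \<omega>))\<^sup>2) \<le> norm (?B \<omega>)"
      by (intro AE_I2) (use le in \<open>fastforce simp: space_M\<close>)
  qed measurable
  then show "transfer f \<in> L2 M" unfolding L2_def by simp
  have "(LINT \<omega>|M. (cmod (transfer f \<omega>))\<^sup>2) \<le> (LINT \<omega>|M. ?B \<omega>)"
    by (intro integral_mono int B) (use le in \<open>simp add: space_M\<close>)
  also have "\<dots> = (LINT \<omega>|M. (cmod (f \<omega>))\<^sup>2)"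
    by (rule integral_sum_extend[OF L2_square_integrable[OF f]])
  finally show "(LINT \<omega>|M. (cmod (transfer f \<omega>))\<^sup>2) \<le> (LINT \<omega>|M. (cmod (f \<omega>))\<^sup>2)" .
qed

lemma koopman_L2: assumes f: "f \<in> L2 M" shows "koopman f \<in> L2 M"
proof -
  note [measurable] = L2_measurable[OF f]
  have "integrable (distr M M shift) (\<lambda>\<omega>. (cmod (f \<omega>))\<^sup>2)"
    unfolding distr_shift by (rule L2_square_integrable[OF f])
  then have "integrable M (\<lambda>\<omega>. (cmod (f (shift \<omega>)))\<^sup>2)"
    by (subst (asm) integrable_distr_eq) auto
  then show ?thesis unfolding L2_def koopman_def by simp
qed

text \<open>\<open>koopman f\<close> takes the constant value \<open>f \<omega>\<close> on the
  preimages of \<open>\<omega>\<close>, so it can be pulled out of the preimage average.\<close>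

lemma transfer_adjoint:
  assumes f: "f \<in> L2 M" and g: "g \<in> L2 M"
  shows "L2_inner M (koopman f) g = L2_inner M f (transfer g)"
proof -
  let ?F = "\<lambda>\<omega>. koopman f \<omega> * cnj (g \<omega>)"
  have "L2_inner M (koopman f) g = (LINT \<omega>|M. (\<Sum>j\<in>{0, 1}. back_prob j (\<omega> 0) *\<^sub>R ?F (extend j \<omega>)))"
    unfolding L2_inner_def
    by (rule integral_sum_extend[OF L2_product_integrable[OF koopman_L2[OF f] g], symmetric])
  also have "\<dots> = (LINT \<omega>|M. f \<omega> * cnj (transfer g \<omega>))"
  proof (rule Bochner_Integration.integral_cong[OF refl])
    fix \<omega> assume "\<omega> \<in> space M"
    then have \<omega>: "\<omega> \<in> Sig" by (simp add: space_M)
    \<comment> \<open>The exceptional case is the junk value of \<open>extend\<close>, whose weight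
      is 0.\<close>
    have "back_prob j (\<omega> 0) *\<^sub>R ?F (extend j \<omega>) =
        f \<omega> * cnj (of_real (back_prob j (\<omega> 0)) * g (extend j \<omega>))" for j
      by (cases "j = 1 \<and> \<omega> 0 = 1")
         (auto simp: back_prob_simps extend_def koopman_def shift_case_nat scaleR_conv_of_real)
    then show "(\<Sum>j\<in>{0, 1}. back_prob j (\<omega> 0) *\<^sub>R ?F (extend j \<omega>)) = f \<omega> * cnj (transfer g \<omega>)"
      using \<omega> by (simp add: transfer_def distrib_left)
  qed
  finally show ?thesis unfolding L2_inner_def .
qed

text \<open>The explicit \<open>transfer g\<close> shows that the choice in
  \<open>perron_frobenius\<close> is not vacuous; adjoints are unique almost everywhere.\<close>

lemma perron_frobenius_AE:
  assumes g: "g \<in> L2 M"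
  shows "AE \<omega> in M. perron_frobenius M g \<omega> = transfer g \<omega>"
proof -
  let ?P = "\<lambda>v. v \<in> L2 M \<and> (\<forall>f \<in> L2 M. L2_inner M (koopman f) g = L2_inner M f v)"
  have "?P (transfer g)" using transfer_L2[OF g] transfer_adjoint[OF _ g] by blast
  then have P: "?P (perron_frobenius M g)"
    unfolding perron_frobenius_def by (rule someI[of ?P])
  show "AE \<omega> in M. perron_frobenius M g \<omega> = transfer g \<omega>"
    by (rule L2_AE_eqI) (use P transfer_L2[OF g] transfer_adjoint[OF _ g] in auto)
qed

text \<open>Existence of a solution is supplied through \<open>g\<close>. Two solutions differ by
  some \<open>d\<close> with \<open>transfer d = \<zeta> * d\<close> almost everywhere, and
  contractivity with \<open>1 < cmod \<zeta>\<close> forces the norm of \<open>d\<close> to be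
  0.\<close>

lemma
  assumes \<zeta>: "1 < cmod \<zeta>" and g: "g \<in> L2 M"
    and eq: "AE \<omega> in M. \<zeta> * g \<omega> - transfer g \<omega> = f \<omega>"
  shows L2_resolvent_L2: "L2_resolvent M \<zeta> f \<in> L2 M"
    and L2_resolvent_AE: "AE \<omega> in M. L2_resolvent M \<zeta> f \<omega> = g \<omega>"
proof -
  let ?P = "\<lambda>g. g \<in> L2 M \<and> (AE \<omega> in M. \<zeta> * g \<omega> - perron_frobenius M g \<omega> = f \<omega>)"
  define r where "r = L2_resolvent M \<zeta> f"
  have "AE \<omega> in M. \<zeta> * g \<omega> - perron_frobenius M g \<omega> = f \<omega>"
    using eq perron_frobenius_AE[OF g] by eventually_elim simp
  then have "?P g" using g by blast
  then have P: "?P r" unfolding r_def L2_resolvent_def by (rule someI[of ?P])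
  then have r: "r \<in> L2 M" by blast
  then show "L2_resolvent M \<zeta> f \<in> L2 M" unfolding r_def .
  define d where "d = (\<lambda>\<omega>. r \<omega> + (-1) * g \<omega>)"
  have d: "d \<in> L2 M" unfolding d_def by (intro L2_add r L2_scale g)
  note [measurable] = L2_measurable[OF d]
  have Td: "transfer d \<omega> = transfer r \<omega> - transfer g \<omega>" and d_eq: "d \<omega> = r \<omega> - g \<omega>" for \<omega>
    unfolding d_def transfer_add transfer_scale by simp_all
  have "AE \<omega> in M. \<zeta> * r \<omega> - perron_frobenius M r \<omega> = f \<omega>" using P by blast
  then have "AE \<omega> in M. transfer d \<omega> = \<zeta> * d \<omega>"
    using perron_frobenius_AE[OF r] eq
    by eventually_elim (simp add: Td d_eq algebra_simps)
  then have "AE \<omega> in M. (cmod (transfer d \<omega>))\<^sup>2 = (cmod \<zeta>)\<^sup>2 * (cmod (d \<omega>))\<^sup>2"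
    by eventually_elim (simp add: norm_mult power_mult_distrib)
  then have "(LINT \<omega>|M. (cmod (transfer d \<omega>))\<^sup>2) = (LINT \<omega>|M. (cmod \<zeta>)\<^sup>2 * (cmod (d \<omega>))\<^sup>2)"
    by (intro integral_cong_AE) measurable
  then have "(cmod \<zeta>)\<^sup>2 * (LINT \<omega>|M. (cmod (d \<omega>))\<^sup>2) \<le> (LINT \<omega>|M. (cmod (d \<omega>))\<^sup>2)"
    using transfer_contraction[OF d] by simp
  moreover have "1 < (cmod \<zeta>)\<^sup>2" using \<zeta> by (simp add: one_less_power)
  moreover have "0 \<le> (LINT \<omega>|M. (cmod (d \<omega>))\<^sup>2)" by simp
  ultimately have "(LINT \<omega>|M. (cmod (d \<omega>))\<^sup>2) = 0"
    using mult_strict_right_mono[of 1 "(cmod \<zeta>)\<^sup>2" "LINT \<omega>|M. (cmod (d \<omega>))\<^sup>2"] by linarith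
  then have "AE \<omega> in M. d \<omega> = 0" by (rule L2_self_integral_eq_0[OF d])
  then show "AE \<omega> in M. L2_resolvent M \<zeta> f \<omega> = g \<omega>"
    unfolding r_def[symmetric] by eventually_elim (simp add: d_def)
qed

end

section \<open>Test functions\<close>

lemma height_summable: assumes "\<omega> \<in> Sig" shows "summable (\<lambda>k. real (\<omega> k) / golden ^ Suc k)"
proof (rule summable_comparison_test')
  show "summable (\<lambda>k. (1 / golden) ^ Suc k)"
    using golden_gt_1 by (subst summable_Suc_iff) (simp add: summable_geometric)
  show "norm (real (\<omega> k) / golden ^ Suc k) \<le> (1 / golden) ^ Suc k" if "k \<ge> 0" for k
    using Sig_letter[OF assms, of k] golden_gt_1 by (auto simp: power_one_over)
qed

lemma height_shift: assumes "\<omega> \<in> Sig" shows "height \<omega> = (real (\<omega> 0) + height (shift \<omega>)) / golden"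
proof -
  have "height \<omega> = (\<Sum>k. real (\<omega> (Suc k)) / golden ^ Suc (Suc k)) + real (\<omega> 0) / golden"
    unfolding height_def using suminf_split_head[OF height_summable[OF assms]] by simp
  also have "(\<Sum>k. real (\<omega> (Suc k)) / golden ^ Suc (Suc k)) = height (shift \<omega>) / golden"
    using suminf_divide[OF height_summable[OF shift_in_Sig[OF assms]], of golden]
    unfolding height_def shift_def by (simp add: mult.commute)
  finally show ?thesis by (simp add: add_divide_distrib)
qed

lemma height_case_nat:
  "case_nat j \<omega> \<in> Sig \<Longrightarrow> height (case_nat j \<omega>) = (real j + height \<omega>) / golden"
  using height_shift[of "case_nat j \<omega>"] by (simp add: shift_case_nat)

text \<open>Formally the height of the inadmissible constant sequence 1; a crude majorant whose
  exact value is irrelevant.\<close>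

definition height_bound :: real where
  "height_bound = (\<Sum>k. (1 / golden) ^ Suc k)"

lemma height_bounds: assumes "\<omega> \<in> Sig" shows "0 \<le> height \<omega>" "height \<omega> \<le> height_bound"
proof -
  show "0 \<le> height \<omega>"
    unfolding height_def using golden_gt_1 by (intro suminf_nonneg height_summable assms) auto
  show "height \<omega> \<le> height_bound"
    unfolding height_def height_bound_def
  proof (rule suminf_le)
    show "real (\<omega> k) / golden ^ Suc k \<le> (1 / golden) ^ Suc k" for k
      using Sig_letter[OF assms, of k] golden_gt_1 by (auto simp: power_one_over)
    show "summable (\<lambda>k. (1 / golden) ^ Suc k)"
      using golden_gt_1 by (subst summable_Suc_iff) (simp add: summable_geometric)
  qed (rule height_summable[OF assms])
qed

text \<open>A common first letter can be shifted off, and by \<open>height_shift\<close> this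
  multiplies the difference of heights by \<open>golden\<close>.\<close>

lemma height_dist_cylinder:
  assumes "\<omega> \<in> Sig" "\<omega>' \<in> Sig" "\<And>k. k < n \<Longrightarrow> \<omega>' k = \<omega> k"
  shows "\<bar>height \<omega>' - height \<omega>\<bar> \<le> height_bound / golden ^ n"
  using assms
proof (induction n arbitrary: \<omega> \<omega>')
  case 0
  then show ?case using height_bounds[of \<omega>] height_bounds[of \<omega>'] by simp
next
  case (Suc n)
  have "\<bar>height (shift \<omega>') - height (shift \<omega>)\<bar> \<le> height_bound / golden ^ n"
    using Suc.prems by (intro Suc.IH) (auto simp: shift_in_Sig, simp add: shift_def)
  then have "\<bar>height (shift \<omega>') - height (shift \<omega>)\<bar> / golden \<le> height_bound / golden ^ n / golden"
    using golden_gt_1 by (intro divide_right_mono) auto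
  moreover have "height \<omega>' - height \<omega> = (height (shift \<omega>') - height (shift \<omega>)) / golden"
    using Suc.prems(3)[of 0]
    by (simp add: height_shift[of \<omega>] height_shift[of \<omega>'] Suc.prems diff_divide_distrib add_divide_distrib)
  ultimately show ?case
    using golden_gt_1 by (simp add: abs_divide mult.commute)
qed

lemma height_tendsto:
  assumes "\<omega> \<in> Sig" "\<And>n. \<omega>s n \<in> Cyl (map \<omega> [0..<n])"
  shows "(\<lambda>n. height (\<omega>s n)) \<longlonglongrightarrow> height \<omega>"
proof (rule Lim_null[THEN iffD2], rule Lim_null_comparison)
  show "\<forall>\<^sub>F n in sequentially. norm (height (\<omega>s n) - height \<omega>) \<le> height_bound * (1 / golden) ^ n"
  proof (intro always_eventually allI)
    fix n
    have "\<bar>height (\<omega>s n) - height \<omega>\<bar> \<le> height_bound / golden ^ n"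
      using assms(2)[of n] by (intro height_dist_cylinder assms(1)) (auto simp: Cyl_def)
    then show "norm (height (\<omega>s n) - height \<omega>) \<le> height_bound * (1 / golden) ^ n"
      by (simp add: power_one_over)
  qed
  have "(\<lambda>n. (1 / golden) ^ n) \<longlonglongrightarrow> 0"
    using golden_gt_1 by (intro LIMSEQ_power_zero) simp
  then show "(\<lambda>n. height_bound * (1 / golden) ^ n) \<longlonglongrightarrow> 0"
    using tendsto_mult_right_zero by blast
qed

section \<open>The test space as a filtered vector space\<close>

interpretation cfun: vector_space "\<lambda>(c :: complex) (f :: cfun) \<omega>. c * f \<omega>"
  by unfold_locales (auto simp: fun_eq_iff algebra_simps)

lemma cfun_subspaceI:
  assumes "(\<lambda>_. 0) \<in> V" "\<And>f g. f \<in> V \<Longrightarrow> g \<in> V \<Longrightarrow> (\<lambda>\<omega>. f \<omega> + g \<omega>) \<in> V"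
    "\<And>c f. f \<in> V \<Longrightarrow> (\<lambda>\<omega>. c * f \<omega>) \<in> V"
  shows "cfun.subspace V"
  using assms unfolding cfun.subspace_def zero_fun_def plus_fun_def by blast

lemma sum_fun_apply: "(\<Sum>x\<in>A. f x) \<omega> = (\<Sum>x\<in>A. f x \<omega>)"
  by (induction A rule: infinite_finite_induct) auto

text \<open>The degree bound is strict, so that \<open>test_span 0\<close> is the zero space and
  \<open>test_span n\<close> has \<open>2 * n\<close> generators; hence the shift in
  \<open>Xn n = test_span (Suc n)\<close>.\<close>

definition test_span :: "nat \<Rightarrow> cfun set" where
  "test_span n = cfun.span ((\<lambda>(j, i). test_fun j i) ` ({0, 1} \<times> {..<n}))"

lemma subspace_test_span: "cfun.subspace (test_span n)"
  unfolding test_span_def by (rule cfun.subspace_span)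

lemma test_span_zero: "(\<lambda>_. 0) \<in> test_span n"
  using cfun.subspace_0[OF subspace_test_span] unfolding zero_fun_def .

lemma test_span_add: "f \<in> test_span n \<Longrightarrow> g \<in> test_span n \<Longrightarrow> (\<lambda>\<omega>. f \<omega> + g \<omega>) \<in> test_span n"
  using cfun.subspace_add[OF subspace_test_span] unfolding plus_fun_def .

lemma test_span_scale: "f \<in> test_span n \<Longrightarrow> (\<lambda>\<omega>. c * f \<omega>) \<in> test_span n"
  by (rule cfun.subspace_scale[OF subspace_test_span])

lemma test_fun_in_test_span: "j \<in> {0, 1} \<Longrightarrow> i < n \<Longrightarrow> test_fun j i \<in> test_span n"
  unfolding test_span_def by (intro cfun.span_base) auto

lemma test_span_sum:
  "(\<And>x. x \<in> A \<Longrightarrow> f x \<in> test_span n) \<Longrightarrow> (\<lambda>\<omega>. \<Sum>x\<in>A. f x \<omega>) \<in> test_span n"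
  using cfun.subspace_sum[OF subspace_test_span, of A f n] by (simp add: sum_fun_apply[abs_def])

lemma test_span_mono: "m \<le> n \<Longrightarrow> test_span m \<subseteq> test_span n"
  unfolding test_span_def by (intro cfun.span_mono image_mono) auto

lemma test_span_minimal:
  "cfun.subspace V \<Longrightarrow> (\<And>j i. j \<in> {0, 1} \<Longrightarrow> i < n \<Longrightarrow> test_fun j i \<in> V) \<Longrightarrow> test_span n \<subseteq> V"
  unfolding test_span_def by (rule cfun.span_minimal) auto

lemma Xn_eq_test_span: "Xn n = test_span (Suc n)"
proof
  show "Xn n \<subseteq> test_span (Suc n)"
    unfolding Xn_def by (auto intro!: test_span_add test_span_sum test_span_scale test_fun_in_test_span)
  have "cfun.subspace (Xn n)"
  proof (rule cfun_subspaceI)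
    show "(\<lambda>_. 0) \<in> Xn n"
      unfolding Xn_def by (auto intro!: exI[of _ "\<lambda>_ _. 0"])
  next
    fix f g assume "f \<in> Xn n" "g \<in> Xn n"
    then obtain c d where "f = (\<lambda>\<omega>. \<Sum>j\<in>{0, 1}. \<Sum>i\<le>n. c j i * test_fun j i \<omega>)"
      "g = (\<lambda>\<omega>. \<Sum>j\<in>{0, 1}. \<Sum>i\<le>n. d j i * test_fun j i \<omega>)"
      unfolding Xn_def by blast
    then have "(\<lambda>\<omega>. f \<omega> + g \<omega>) = (\<lambda>\<omega>. \<Sum>j\<in>{0, 1}. \<Sum>i\<le>n. (c j i + d j i) * test_fun j i \<omega>)"
      by (simp add: fun_eq_iff sum.distrib distrib_right)
    then show "(\<lambda>\<omega>. f \<omega> + g \<omega>) \<in> Xn n"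
      unfolding Xn_def by (auto intro!: exI[of _ "\<lambda>j i. c j i + d j i"])
  next
    fix b f assume "f \<in> Xn n"
    then obtain c where "f = (\<lambda>\<omega>. \<Sum>j\<in>{0, 1}. \<Sum>i\<le>n. c j i * test_fun j i \<omega>)"
      unfolding Xn_def by blast
    then have "(\<lambda>\<omega>. b * f \<omega>) = (\<lambda>\<omega>. \<Sum>j\<in>{0, 1}. \<Sum>i\<le>n. (b * c j i) * test_fun j i \<omega>)"
      by (simp add: fun_eq_iff sum_distrib_left distrib_left mult.assoc)
    then show "(\<lambda>\<omega>. b * f \<omega>) \<in> Xn n"
      unfolding Xn_def by (auto intro!: exI[of _ "\<lambda>j i. b * c j i"])
  qed
  then show "test_span (Suc n) \<subseteq> Xn n"
  proof (rule test_span_minimal)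
    fix j i :: nat assume *: "j \<in> {0, 1}" "i < Suc n"
    have "test_fun j i = (\<lambda>\<omega>. \<Sum>j'\<in>{0, 1}. \<Sum>i'\<le>n. (if j' = j then if i' = i then 1 else 0 else 0) * test_fun j' i' \<omega>)"
      using * by (auto simp: fun_eq_iff if_distrib[of "\<lambda>x. x * _"] cong: if_cong)
    then show "test_fun j i \<in> Xn n"
      unfolding Xn_def by (intro CollectI exI)
  qed
qed

lemma X_eq_test_span: "X = (\<Union>n. test_span n)"
  unfolding X_def Xn_eq_test_span
  using test_span_mono[OF lessI[THEN less_imp_le]] by blast

lemma X_obtain: assumes "f \<in> X" obtains n where "f \<in> test_span n"
  using assms unfolding X_eq_test_span by blast

lemma X_obtain2: assumes "f \<in> X" "g \<in> X" obtains n where "f \<in> test_span n" "g \<in> test_span n"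
proof -
  obtain m k where "f \<in> test_span m" "g \<in> test_span k"
    using assms X_obtain by metis
  then show ?thesis
    using that[of "max m k"] test_span_mono[of m "max m k"] test_span_mono[of k "max m k"] by auto
qed

lemma test_span_subset_X: "test_span n \<subseteq> X"
  unfolding X_eq_test_span by blast

lemma X_combination:
  assumes "f \<in> X" "g \<in> X" shows "(\<lambda>\<omega>. a * f \<omega> + b * g \<omega>) \<in> X"
proof -
  obtain n where "f \<in> test_span n" "g \<in> test_span n" using assms by (rule X_obtain2)
  then have "(\<lambda>\<omega>. a * f \<omega> + b * g \<omega>) \<in> test_span n" by (intro test_span_add test_span_scale)
  then show ?thesis using test_span_subset_X by blast
qed

text \<open>Serves as induction principle: a property of test functions that is stable under linear
  operations need only be checked on the generators.\<close>

lemma X_minimal: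
  assumes "cfun.subspace V" "\<And>j i. j \<in> {0, 1} \<Longrightarrow> test_fun j i \<in> V" shows "X \<subseteq> V"
  unfolding X_eq_test_span using test_span_minimal[OF assms(1)] assms(2) by blast

lemma X_zero_outside: assumes "f \<in> X" "\<omega> \<notin> Sig" shows "f \<omega> = 0"
proof -
  have "X \<subseteq> {f. f \<omega> = 0}"
    using Cyl_subset_Sig assms(2)
    by (intro X_minimal cfun_subspaceI) (auto simp: test_fun_def indicator_def)
  then show ?thesis using assms(1) by blast
qed

text \<open>Continuity of test functions, phrased with shrinking cylinders. The height converges,
  and the indicator of the first letter is constant once the cylinder fixes that letter, that is for
  \<open>n > 0\<close>.\<close>

lemma X_tendsto:
  assumes "f \<in> X" "\<omega> \<in> Sig" "\<And>n. \<omega>s n \<in> Cyl (map \<omega> [0..<n])"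
  shows "(\<lambda>n. f (\<omega>s n)) \<longlonglongrightarrow> f \<omega>"
proof -
  have "X \<subseteq> {f. (\<lambda>n. f (\<omega>s n)) \<longlonglongrightarrow> f \<omega>}"
  proof (intro X_minimal cfun_subspaceI CollectI)
    fix j i
    have "\<forall>\<^sub>F n in sequentially. indicator (Cyl [j]) \<omega> * of_real (height (\<omega>s n)) ^ i = test_fun j i (\<omega>s n)"
      using eventually_gt_at_top[of 0]
    proof eventually_elim
      case (elim n)
      then have "\<omega>s n \<in> Sig" "\<omega>s n 0 = \<omega> 0"
        using assms(3)[of n] by (auto simp: Cyl_def)
      then have "(indicator (Cyl [j]) (\<omega>s n) :: complex) = indicator (Cyl [j]) \<omega>"
        using assms(2) by (auto simp: indicator_def in_Cyl_Cons Cyl_Nil shift_in_Sig)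
      then show ?case by (simp add: test_fun_def)
    qed
    moreover have "(\<lambda>n. indicator (Cyl [j]) \<omega> * of_real (height (\<omega>s n)) ^ i :: complex) \<longlonglongrightarrow> test_fun j i \<omega>"
      unfolding test_fun_def by (intro tendsto_intros height_tendsto assms)
    ultimately show "(\<lambda>n. test_fun j i (\<omega>s n)) \<longlonglongrightarrow> test_fun j i \<omega>"
      by (rule Lim_transform_eventually[rotated])
  qed (auto intro: tendsto_intros)
  then show ?thesis using assms(1) by blast
qed

section \<open>The transfer operator on powers of the height\<close>

lemma test_fun_case_nat:
  assumes "\<omega> \<in> Sig" "case_nat a \<omega> \<in> Sig"
  shows "test_fun j i (case_nat a \<omega>) =
    (if a = j then ((of_nat a + of_real (height \<omega>)) / of_real golden) ^ i else 0)"
  using assms by (simp add: test_fun_def indicator_def in_Cyl_Cons Cyl_Nil shift_case_nat height_case_nat)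

text \<open>Prefixing 0 is always admissible and divides the height by \<open>golden\<close>; the
  weight is \<open>1 / golden\<close> if the sequence starts with 0, and 1 if it starts with
  1.\<close>

lemma transfer_test_fun_0:
  "transfer (test_fun 0 i) = (\<lambda>\<omega>. 1 / of_real golden ^ i *
     (1 / of_real golden * test_fun 0 i \<omega> + test_fun 1 i \<omega>))"
proof
  fix \<omega>
  show "transfer (test_fun 0 i) \<omega> = 1 / of_real golden ^ i *
     (1 / of_real golden * test_fun 0 i \<omega> + test_fun 1 i \<omega>)"
  proof (cases "\<omega> \<in> Sig")
    case True
    have 0: "extend 0 \<omega> = case_nat 0 \<omega>" "case_nat 0 \<omega> \<in> Sig"
      using extend_in_Sig[OF True, of 0] by (simp_all add: extend_def)
    have ext1: "back_prob 1 (\<omega> 0) = 0 \<or> test_fun 0 i (extend 1 \<omega>) = 0"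
      using Sig_letter[OF True, of 0] 
      by (auto simp: back_prob_simps extend_def test_fun_def indicator_def in_Cyl_Cons)
    then show ?thesis
      using Sig_letter[OF True, of 0] True
      by (auto simp: transfer_def 0 test_fun_case_nat back_prob_simps power_divide)
         (auto simp: test_fun_def indicator_def in_Cyl_Cons Cyl_Nil shift_in_Sig)
  qed (auto simp: transfer_def test_fun_def indicator_def in_Cyl_Cons)
qed

text \<open>Prefixing 1 is admissible only before 0, with weight \<open>1 / golden ^ 2\<close>, and
  turns the height \<open>h\<close> into \<open>(1 + h) / golden\<close>. The binomial expansion of
  the power produces the terms of lower degree.\<close>

lemma transfer_test_fun_1:
  "transfer (test_fun 1 i) = (\<lambda>\<omega>. 1 / of_real golden ^ (i + 2) *
     (\<Sum>k\<le>i. of_nat (i choose k) * test_fun 0 k \<omega>))"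
proof
  fix \<omega>
  show "transfer (test_fun 1 i) \<omega> = 1 / of_real golden ^ (i + 2) *
     (\<Sum>k\<le>i. of_nat (i choose k) * test_fun 0 k \<omega>)"
  proof (cases "\<omega> \<in> Sig \<and> \<omega> 0 = 0")
    case True
    have 1: "extend (Suc 0) \<omega> = case_nat (Suc 0) \<omega>" "case_nat (Suc 0) \<omega> \<in> Sig"
      using extend_in_Sig[of \<omega> 1] True by (simp_all add: extend_def)
    have 0: "test_fun (Suc 0) i (extend 0 \<omega>) = 0"
      by (simp add: extend_def test_fun_def indicator_def in_Cyl_Cons)
    have "transfer (test_fun 1 i) \<omega> = (of_real (height \<omega>) + 1) ^ i / of_real golden ^ (i + 2)"
      using True
      by (simp add: transfer_def 0 1 test_fun_case_nat back_prob_simps power_divide add.commute power_add power2_eq_square)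
    also have "(of_real (height \<omega>) + 1) ^ i = (\<Sum>k\<le>i. of_nat (i choose k) * test_fun 0 k \<omega> :: complex)"
      using True
      by (simp add: binomial_ring test_fun_def indicator_def in_Cyl_Cons Cyl_Nil shift_in_Sig)
    finally show ?thesis by simp
  next
    case False
    have "test_fun (Suc 0) i (extend 0 \<omega>) = 0"
      by (simp add: extend_def test_fun_def indicator_def in_Cyl_Cons)
    then have "transfer (test_fun 1 i) \<omega> = 0"
      using False Sig_letter[of \<omega> 0] by (auto simp: transfer_def back_prob_simps)
    moreover have "test_fun 0 k \<omega> = 0" for k
      using False by (auto simp: test_fun_def indicator_def in_Cyl_Cons)
    ultimately show ?thesis by simp
  qed
qed

lemma transfer_test_span: assumes "f \<in> test_span n" shows "transfer f \<in> test_span n"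
proof -
  have "test_span n \<subseteq> {f. transfer f \<in> test_span n}"
  proof (intro test_span_minimal cfun_subspaceI CollectI)
    have "transfer (\<lambda>_. 0) = (\<lambda>_. 0)" by (auto simp: transfer_def)
    then show "transfer (\<lambda>_. 0) \<in> test_span n" using test_span_zero by simp
  next
    fix f g assume "f \<in> {f. transfer f \<in> test_span n}" "g \<in> {f. transfer f \<in> test_span n}"
    then show "transfer (\<lambda>\<omega>. f \<omega> + g \<omega>) \<in> test_span n"
      by (simp add: transfer_add[abs_def] test_span_add)
  next
    fix c f assume "f \<in> {f. transfer f \<in> test_span n}"
    then show "transfer (\<lambda>\<omega>. c * f \<omega>) \<in> test_span n"
      by (simp add: transfer_scale[abs_def] test_span_scale)
  next
    fix j i :: nat assume "j \<in> {0, 1}" "i < n"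
    then show "transfer (test_fun j i) \<in> test_span n"
    proof (elim insertE emptyE)
      assume "j = 0"
      then show ?thesis
        using \<open>i < n\<close> unfolding \<open>j = 0\<close> transfer_test_fun_0
        by (intro test_span_scale test_span_add test_fun_in_test_span) auto
    next
      assume "j = 1"
      then show ?thesis
        using \<open>i < n\<close> unfolding \<open>j = 1\<close> transfer_test_fun_1
        by (intro test_span_scale test_span_sum test_fun_in_test_span) auto
    qed
  qed
  then show ?thesis using assms by blast
qed

lemma test_span_Suc_obtain:
  assumes "f \<in> test_span (Suc n)"
  obtains a b g where "g \<in> test_span n"
    "\<And>\<omega>. f \<omega> = a * test_fun 0 n \<omega> + b * test_fun 1 n \<omega> + g \<omega>"
proof -
  let ?V = "{f. \<exists>a b. \<exists>g \<in> test_span n. \<forall>\<omega>. f \<omega> = a * test_fun 0 n \<omega> + b * test_fun 1 n \<omega> + g \<omega>}"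
  have "test_span (Suc n) \<subseteq> ?V"
  proof (intro test_span_minimal cfun_subspaceI)
    show "(\<lambda>_. 0) \<in> ?V"
      by (intro CollectI exI[of _ 0] bexI[OF _ test_span_zero]) simp
  next
    fix f g assume "f \<in> ?V" "g \<in> ?V"
    then obtain a b u c d v where "u \<in> test_span n" "v \<in> test_span n"
      and "\<forall>\<omega>. f \<omega> = a * test_fun 0 n \<omega> + b * test_fun 1 n \<omega> + u \<omega>"
      and "\<forall>\<omega>. g \<omega> = c * test_fun 0 n \<omega> + d * test_fun 1 n \<omega> + v \<omega>"
      by blast
    then show "(\<lambda>\<omega>. f \<omega> + g \<omega>) \<in> ?V"
      by (intro CollectI exI[of _ "a + c"] exI[of _ "b + d"] bexI[OF _ test_span_add[of u n v]])
         (simp_all add: algebra_simps)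
  next
    fix c f assume "f \<in> ?V"
    then obtain a b u where "u \<in> test_span n"
      and "\<forall>\<omega>. f \<omega> = a * test_fun 0 n \<omega> + b * test_fun 1 n \<omega> + u \<omega>"
      by blast
    then show "(\<lambda>\<omega>. c * f \<omega>) \<in> ?V"
      by (intro CollectI exI[of _ "c * a"] exI[of _ "c * b"] bexI[OF _ test_span_scale[of u n c]])
         (simp_all add: algebra_simps)
  next
    fix j i :: nat assume *: "j \<in> {0, 1}" "i < Suc n"
    show "test_fun j i \<in> ?V"
    proof (cases "i = n")
      case True
      then show ?thesis
        using *
        by (intro CollectI exI[of _ "if j = 0 then 1 else 0"] exI[of _ "if j = 0 then 0 else 1"]
            bexI[OF _ test_span_zero]) auto
    next
      case False
      then have "test_fun j i \<in> test_span n" using * by (intro test_fun_in_test_span) auto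
      then show ?thesis
        by (intro CollectI exI[of _ 0] bexI[of _ "test_fun j i"]) auto
    qed
  qed
  then show ?thesis using assms that by blast
qed

text \<open>The column \<open>(a, b)\<close> of top coefficients is mapped by P, up to the factor
  \<open>1 / golden ^ n\<close>. The remainder \<open>h\<close> collects the lower binomial terms of
  \<open>transfer (test_fun 1 n)\<close> and \<open>transfer g\<close>.\<close>

lemma transfer_top_coeffs:
  assumes "g \<in> test_span n"
    and f: "\<And>\<omega>. f \<omega> = a * test_fun 0 n \<omega> + b * test_fun 1 n \<omega> + g \<omega>"
  obtains h where "h \<in> test_span n"
    "\<And>\<omega>. transfer f \<omega> = 1 / of_real golden ^ n *
      ((a / of_real golden + b / of_real golden ^ 2) * test_fun 0 n \<omega> + a * test_fun 1 n \<omega>) + h \<omega>"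
proof -
  let ?r = "\<lambda>\<omega>. \<Sum>k<n. of_nat (n choose k) * test_fun 0 k \<omega>"
  have 1: "transfer (test_fun 1 n) = (\<lambda>\<omega>. 1 / of_real golden ^ (n + 2) * (test_fun 0 n \<omega> + ?r \<omega>))"
    unfolding transfer_test_fun_1 by (simp add: lessThan_Suc_atMost[symmetric] add.commute)
  let ?h = "\<lambda>\<omega>. (b * (1 / of_real golden ^ (n + 2))) * ?r \<omega> + transfer g \<omega>"
  have "f = (\<lambda>\<omega>. (\<lambda>\<omega>. a * test_fun 0 n \<omega> + b * test_fun 1 n \<omega>) \<omega> + g \<omega>)"
    using f by auto
  then have "transfer f \<omega> = a * transfer (test_fun 0 n) \<omega> + b * transfer (test_fun 1 n) \<omega> + transfer g \<omega>" for \<omega>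
    by (simp only: transfer_add transfer_scale)
  then have "transfer f \<omega> = 1 / of_real golden ^ n *
      ((a / of_real golden + b / of_real golden ^ 2) * test_fun 0 n \<omega> + a * test_fun 1 n \<omega>) + ?h \<omega>" for \<omega>
    unfolding 1 transfer_test_fun_0
    by (simp add: algebra_simps add_divide_distrib power_add power2_eq_square)
  moreover have "?h \<in> test_span n"
    by (intro test_span_add test_span_scale transfer_test_span assms test_span_sum test_fun_in_test_span) auto
  ultimately show ?thesis using that by blast
qed

text \<open>By Cayley-Hamilton for the block \<open>golden\<^sup>-\<^sup>n P\<close>, which \<open>transfer\<close> induces on
  \<open>test_span (Suc n)\<close> modulo \<open>test_span n\<close>.\<close>

lemma transfer_eigenvector_degree:
  assumes f: "f \<in> test_span (Suc n)" and eig: "\<And>\<omega>. transfer f \<omega> = l * f \<omega>"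
    and ne: "l \<noteq> of_real (1 / golden ^ n)" "l \<noteq> - of_real (1 / golden ^ (n + 2))"
  shows "f \<in> test_span n"
proof -
  define x where "x = (1 / of_real golden :: complex)"
  obtain a b g where g: "g \<in> test_span n"
    and fg: "\<And>\<omega>. f \<omega> = a * test_fun 0 n \<omega> + b * test_fun 1 n \<omega> + g \<omega>"
    using test_span_Suc_obtain[OF f] by blast
  obtain h where h: "h \<in> test_span n"
    and fh: "\<And>\<omega>. transfer f \<omega> = 1 / of_real golden ^ n *
      ((a / of_real golden + b / of_real golden ^ 2) * test_fun 0 n \<omega> + a * test_fun 1 n \<omega>) + h \<omega>"
    using transfer_top_coeffs[OF g fg] by blast
  have fh': "transfer f \<omega> = x ^ n * (a * x + b * x ^ 2) * test_fun 0 n \<omega> + x ^ n * a * test_fun 1 n \<omega> + h \<omega>" for \<omega>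
    unfolding fh x_def by (simp add: power_one_over algebra_simps add_divide_distrib)
  obtain k where k: "k \<in> test_span n"
    and fk: "\<And>\<omega>. transfer (transfer f) \<omega> = 1 / of_real golden ^ n *
      ((x ^ n * (a * x + b * x ^ 2) / of_real golden + x ^ n * a / of_real golden ^ 2) * test_fun 0 n \<omega>
        + x ^ n * (a * x + b * x ^ 2) * test_fun 1 n \<omega>) + k \<omega>"
    using transfer_top_coeffs[OF h fh'] by blast
  have fk': "transfer (transfer f) \<omega> = x ^ n * ((x ^ n * (a * x + b * x ^ 2) * x + x ^ n * a * x ^ 2) * test_fun 0 n \<omega>
        + x ^ n * (a * x + b * x ^ 2) * test_fun 1 n \<omega>) + k \<omega>" for \<omega>
    unfolding fk x_def by (simp add: power_one_over algebra_simps add_divide_distrib)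
  have x: "x ^ 2 = 1 - x"
    using golden_inverse unfolding x_def
    by (metis (mono_tags, opaque_lifting) add_diff_cancel_left' of_real_1 of_real_diff of_real_divide of_real_power power_one_over)
  define y where "y = x ^ n"
  \<comment> \<open>The characteristic polynomial of the block at \<open>l\<close>: the roots are
    \<open>y\<close> and \<open>- y * x ^ 2\<close>, so by \<open>1 - x ^ 2 = x\<close> the trace is
    \<open>y * x\<close>, and the determinant is \<open>- (y ^ 2 * x ^ 2)\<close>.\<close>
  define D where "D = (l - y) * (l + y * x ^ 2)"
  have "transfer (transfer f) \<omega> = l ^ 2 * f \<omega>" for \<omega>
  proof -
    have "transfer f = (\<lambda>\<omega>. l * f \<omega>)" using eig by auto
    then show ?thesis by (simp add: transfer_scale eig power2_eq_square)
  qed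
  then have "D * f \<omega> = transfer (transfer f) \<omega> - y * x * transfer f \<omega> - y ^ 2 * x ^ 2 * f \<omega>" for \<omega>
    unfolding D_def eig x by (simp add: power2_eq_square algebra_simps)
  \<comment> \<open>In this polynomial of \<open>transfer\<close> the coefficients of both functions
    of degree \<open>n\<close> cancel, and only the remainders \<open>k\<close>, \<open>h\<close>,
    \<open>g\<close> of lower degree survive.\<close>
  also have "\<dots> \<omega> = k \<omega> + (- (y * x)) * h \<omega> + (- (y ^ 2 * x ^ 2)) * g \<omega>" for \<omega>
    unfolding fk' fh' fg y_def[symmetric] by (simp add: power2_eq_square algebra_simps)
  finally have *: "D * f \<omega> = k \<omega> + (- (y * x)) * h \<omega> + (- (y ^ 2 * x ^ 2)) * g \<omega>" for \<omega> .
  have "D \<noteq> 0"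
    using ne unfolding D_def y_def x_def
    by (auto simp: power_one_over power_add eq_neg_iff_add_eq_0 of_real_divide power2_eq_square ac_simps)
  then have "f = (\<lambda>\<omega>. 1 / D * (k \<omega> + (- (y * x)) * h \<omega> + (- (y ^ 2 * x ^ 2)) * g \<omega>))"
    unfolding *[symmetric] by (simp add: fun_eq_iff)
  moreover have "\<dots> \<in> test_span n"
    by (intro test_span_scale test_span_add g h k)
  ultimately show ?thesis by simp
qed

section \<open>Embedding of the test space into the square-integrable functions\<close>

context golden_markov
begin

lemma height_measurable[measurable]: "height \<in> borel_measurable M"
proof -
  have [measurable]: "(\<lambda>\<omega>. real (\<omega> k)) \<in> borel_measurable M" for k
    by (rule measurable_compose[OF letter_measurable]) simp
  show ?thesis unfolding height_def[abs_def] by measurable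
qed

lemma test_fun_L2: "test_fun j i \<in> L2 M"
proof -
  have [measurable]: "test_fun j i \<in> borel_measurable M"
    unfolding test_fun_def by measurable
  have "integrable M (\<lambda>\<omega>. (cmod (test_fun j i \<omega>))\<^sup>2)"
  proof (rule integrable_const_bound)
    show "AE \<omega> in M. norm ((cmod (test_fun j i \<omega>))\<^sup>2) \<le> (height_bound ^ i)\<^sup>2"
    proof (intro AE_I2)
      fix \<omega> assume "\<omega> \<in> space M"
      then have "\<bar>height \<omega>\<bar> ^ i \<le> height_bound ^ i" "0 \<le> height_bound ^ i"
        using height_bounds[of \<omega>] by (auto simp: space_M intro!: power_mono)
      then show "norm ((cmod (test_fun j i \<omega>))\<^sup>2) \<le> (height_bound ^ i)\<^sup>2"
        by (auto simp: test_fun_def norm_mult norm_power indicator_def intro!: power_mono)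
    qed
  qed measurable
  then show ?thesis unfolding L2_def by simp
qed

lemma X_subset_L2: "X \<subseteq> L2 M"
proof (intro X_minimal cfun_subspaceI)
  show "(\<lambda>_. 0) \<in> L2 M" unfolding L2_def by simp
qed (auto intro: L2_add L2_scale test_fun_L2)

text \<open>By full support every cylinder around \<open>\<omega>\<close> contains a zero of
  \<open>f\<close>; such zeros approach \<open>\<omega>\<close>, and \<open>f\<close> is continuous
  along them.\<close>

lemma X_AE_eq_0: assumes f: "f \<in> X" and ae: "AE \<omega> in M. f \<omega> = 0" shows "f = (\<lambda>_. 0)"
proof
  fix \<omega>
  show "f \<omega> = 0"
  proof (cases "\<omega> \<in> Sig")
    case True
    have "\<exists>\<omega>'. \<omega>' \<in> Cyl (map \<omega> [0..<n]) \<and> f \<omega>' = 0" for n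
    proof (rule ccontr)
      assume no: "\<not> ?thesis"
      \<comment> \<open>\<open>emeasure_Cyl\<close> concerns nonempty words only, so one more letter
        is fixed to cover \<open>n = 0\<close>.\<close>
      have "Cyl (map \<omega> [0..<Suc n]) \<subseteq> Cyl (map \<omega> [0..<n])"
        unfolding Cyl_def by (auto simp del: upt_Suc)
      then have "AE \<omega>' in M. \<omega>' \<notin> Cyl (map \<omega> [0..<Suc n])"
        using ae no by (auto elim!: eventually_mono)
      then have "emeasure M (Cyl (map \<omega> [0..<Suc n])) = 0"
        using AE_iff_null_sets[OF Cyl_sets] by blast
      moreover have "emeasure M (Cyl (map \<omega> [0..<Suc n])) = ennreal (word_weight (map \<omega> [0..<Suc n]))"
        using Sig_letter[OF True] by (intro emeasure_Cyl) (simp_all add: image_subset_iff del: upt_Suc)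
      ultimately show False
        using word_weight_pos[OF True, of "Suc n"] by (simp add: ennreal_eq_0_iff del: upt_Suc)
    qed
    then obtain \<omega>s where "\<And>n. \<omega>s n \<in> Cyl (map \<omega> [0..<n])" "\<And>n. f (\<omega>s n) = 0" by metis
    then have "(\<lambda>_ :: nat. 0) \<longlonglongrightarrow> f \<omega>"
      using X_tendsto[OF f True, of \<omega>s] by simp
    then show ?thesis by (simp add: LIMSEQ_const_iff)
  qed (use X_zero_outside[OF f] in simp)
qed

lemma X_AE_eqI: assumes "f \<in> X" "g \<in> X" "AE \<omega> in M. f \<omega> = g \<omega>" shows "f = g"
proof -
  have "(\<lambda>\<omega>. 1 * f \<omega> + (-1) * g \<omega>) = (\<lambda>_. 0)"
    by (rule X_AE_eq_0[OF X_combination[OF assms(1,2)]]) (use assms(3) in auto)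
  then show ?thesis by (auto simp: fun_eq_iff)
qed

text \<open>\<open>transfer\<close> does not raise degrees, so it yields a version of the image
  inside \<open>X\<close>, and there is only one such version. From here on the operator can be
  computed pointwise.\<close>

lemma pf_X_eq_transfer: assumes f: "f \<in> X" shows "pf_X M f = transfer f"
  unfolding pf_X_def
proof (rule the_equality)
  have T: "transfer f \<in> X"
    using f transfer_test_span test_span_subset_X unfolding X_eq_test_span by blast
  have pf: "AE \<omega> in M. perron_frobenius M f \<omega> = transfer f \<omega>"
    using perron_frobenius_AE X_subset_L2 f by blast
  then show "transfer f \<in> X \<and> (AE \<omega> in M. transfer f \<omega> = perron_frobenius M f \<omega>)"
    using T by auto
  fix g assume g: "g \<in> X \<and> (AE \<omega> in M. g \<omega> = perron_frobenius M f \<omega>)"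
  then have "AE \<omega> in M. g \<omega> = transfer f \<omega>" using pf by auto
  then show "g = transfer f" using X_AE_eqI g T by blast
qed

end

section \<open>Eigenvalues and the dual of the test space\<close>

lemma UNIV_branch: "UNIV = {Plus, Minus}"
  using branch.exhaust by blast

lemma finite_UNIV_branch[simp]: "finite (UNIV :: branch set)"
  by (simp add: UNIV_branch)

lemma eigval_inj: assumes "eigval p m = eigval q n" shows "p = q \<and> m = n"
proof -
  have pos: "1 / golden ^ i > 0" for i using golden_gt_1 by simp
  have ne: "of_real (1 / golden ^ i) \<noteq> (- of_real (1 / golden ^ k) :: complex)" for i k
  proof
    assume "of_real (1 / golden ^ i) = (- of_real (1 / golden ^ k) :: complex)"
    then have "of_real (1 / golden ^ i) = (of_real (- (1 / golden ^ k)) :: complex)" by simp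
    then have "1 / golden ^ i = - (1 / golden ^ k)" by (simp only: of_real_eq_iff)
    then show False using pos[of i] pos[of k] by linarith
  qed
  have inj: "i = k" if "(of_real (1 / golden ^ i) :: complex) = of_real (1 / golden ^ k)" for i k
  proof -
    have "1 / golden ^ i = 1 / golden ^ k" using that by (simp only: of_real_eq_iff)
    then have "golden ^ i = golden ^ k" by simp
    then show ?thesis using golden_gt_1 by simp
  qed
  show ?thesis
    using assms inj[of m n] inj[of "m + 2" "n + 2"] ne[of m "n + 2"] ne[of n "m + 2"]
    unfolding eigval_def by (auto split: branch.splits simp del: of_real_divide of_real_power power_Suc)
qed

lemma eigval_nonzero: "eigval p n \<noteq> 0"
  using golden_gt_1 unfolding eigval_def by (auto split: branch.splits)

lemma norm_eigval_le: "cmod (eigval p n) \<le> 1 / golden ^ n"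
proof -
  have "1 / golden ^ (n + 2) \<le> 1 / golden ^ n"
    using golden_gt_1 by (intro divide_left_mono power_increasing) auto
  then show ?thesis
    using golden_gt_1 unfolding eigval_def
    by (auto split: branch.splits simp: norm_divide norm_power simp del: power_Suc power_add)
qed

lemma norm_eigval_le_1: "cmod (eigval p n) \<le> 1"
proof -
  have "1 / golden ^ n \<le> 1" using golden_gt_1 by simp
  then show ?thesis using norm_eigval_le order_trans by blast
qed

definition eigvals :: "complex set" where
  "eigvals = range (\<lambda>(p, n). eigval p n)"

lemma eigvals_eq:
  "eigvals = {of_real (1 / golden ^ n) | n. True} \<union> {- of_real (1 / golden ^ (n + 2)) | n. True}"
proof -
  have "eigvals = range (eigval Plus) \<union> range (eigval Minus)"
    unfolding eigvals_def using branch.exhaust by (auto simp: image_iff) metis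
  then show ?thesis
    unfolding eigval_def by (auto simp: image_iff)
qed

lemma finite_large_eigvals: assumes "r > 0" shows "finite {z \<in> eigvals. cmod z \<ge> r}"
proof -
  obtain m where m: "(1 / golden) ^ m < r"
    using real_arch_pow_inv[OF assms, of "1 / golden"] golden_gt_1 by auto
  have "{z \<in> eigvals. cmod z \<ge> r} \<subseteq> (\<lambda>(p, n). eigval p n) ` (UNIV \<times> {..<m})"
  proof
    fix z assume "z \<in> {z \<in> eigvals. cmod z \<ge> r}"
    then obtain p n where z: "z = eigval p n" "cmod z \<ge> r"
      unfolding eigvals_def by auto
    have "n < m"
    proof (rule ccontr)
      assume "\<not> n < m"
      then have "(1 / golden) ^ n \<le> (1 / golden) ^ m"
        using golden_gt_1 by (intro power_decreasing) auto
      then show False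
        using z m norm_eigval_le[of p n] by (simp add: power_one_over)
    qed
    then show "z \<in> (\<lambda>(p, n). eigval p n) ` (UNIV \<times> {..<m})"
      using z by auto
  qed
  then show ?thesis by (rule finite_subset) simp
qed

text \<open>Stated for every nonzero \<open>z\<close>, whether an eigenvalue or not, so that it
  gives both closedness of \<open>insert 0 eigvals\<close> and isolation of each eigenvalue.\<close>

lemma eigvals_isolated: assumes "z \<noteq> 0" obtains r where "r > 0" "ball z r \<inter> insert 0 eigvals \<subseteq> {z}"
proof -
  have "finite {w \<in> eigvals. cmod w \<ge> cmod z / 2}"
    using assms by (intro finite_large_eigvals) simp
  then obtain d where d: "d > 0" "\<And>w. w \<in> eigvals \<Longrightarrow> cmod w \<ge> cmod z / 2 \<Longrightarrow> w \<noteq> z \<Longrightarrow> d \<le> dist z w"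
    using finite_set_avoid[of _ z] by blast
  \<comment> \<open>Radius at most \<open>cmod z / 2\<close> excludes 0 and all eigenvalues of
    modulus below \<open>cmod z / 2\<close>; the finitely many others, apart from \<open>z\<close>,
    are at distance at least \<open>d\<close>.\<close>
  have "ball z (min d (cmod z / 2)) \<inter> insert 0 eigvals \<subseteq> {z}"
  proof
    fix w assume w: "w \<in> ball z (min d (cmod z / 2)) \<inter> insert 0 eigvals"
    then have "cmod z \<le> cmod w + cmod (z - w)" "cmod (z - w) < cmod z / 2" "dist z w < d"
      using norm_triangle_ineq[of w "z - w"] by (auto simp: dist_norm)
    then have "cmod w \<ge> cmod z / 2" by linarith
    moreover from this have "w \<noteq> 0" using assms by auto
    ultimately show "w \<in> {z}"
      using w d(2)[of w] \<open>dist z w < d\<close> by force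
  qed
  then show ?thesis using that d(1) assms by (metis min_less_iff_conj half_gt_zero zero_less_norm_iff)
qed

lemma closed_eigvals: "closed (insert 0 eigvals)"
proof -
  have "\<exists>r>0. ball z r \<subseteq> - insert 0 eigvals" if z: "z \<notin> insert 0 eigvals" for z
  proof -
    obtain r where "r > 0" "ball z r \<inter> insert 0 eigvals \<subseteq> {z}"
      using eigvals_isolated[of z] z by blast
    then show ?thesis using z by blast
  qed
  then show ?thesis unfolding closed_def open_contains_ball by blast
qed

lemma countable_eigvals: "countable (insert 0 eigvals)"
proof -
  have "countable (UNIV \<times> UNIV :: (branch \<times> nat) set)"
    by (intro countable_SIGMA) (simp_all add: countable_finite)
  then show ?thesis unfolding eigvals_def by simp
qed

lemma eigval_near_0: assumes "r > 0" obtains n where "eigval Plus n \<in> ball 0 r"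
proof -
  obtain m where "(1 / golden) ^ m < r"
    using real_arch_pow_inv[OF assms, of "1 / golden"] golden_gt_1 by auto
  then show ?thesis
    using that[of m] norm_eigval_le[of Plus m] by (simp add: power_one_over)
qed

lemma interior_countable: "countable S \<Longrightarrow> interior S = {}" for S :: "complex set"
proof (rule equals0I)
  fix z assume "countable S" "z \<in> interior S"
  then obtain e where "e > 0" "ball z e \<subseteq> S" by (auto simp: mem_interior)
  then show False using \<open>countable S\<close> uncountable_ball[of e z] countable_subset by blast
qed

text \<open>By continuity \<open>(\<zeta> - z) * q \<zeta>\<close> tends to 0 at \<open>z\<close>,
  while it equals \<open>c\<close> off \<open>T\<close>. Every ball about \<open>z\<close> is
  uncountable, so it meets the complement of the countable set \<open>T\<close> in points other than
  \<open>z\<close>.\<close>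

lemma no_simple_pole:
  fixes q :: "complex \<Rightarrow> complex"
  assumes "open U" "z \<in> U" "q holomorphic_on U" "countable T"
    and eq: "\<And>\<zeta>. \<zeta> \<in> U - T \<Longrightarrow> (\<zeta> - z) * q \<zeta> = c"
  shows "c = 0"
proof (rule ccontr)
  assume "c \<noteq> 0"
  have "continuous_on U (\<lambda>\<zeta>. (\<zeta> - z) * q \<zeta> - c)"
    using assms(3) by (intro continuous_intros holomorphic_on_imp_continuous_on)
  then have "isCont (\<lambda>\<zeta>. (\<zeta> - z) * q \<zeta> - c) z"
    using assms(1,2) by (simp add: continuous_on_eq_continuous_at)
  then have "\<forall>\<^sub>F \<zeta> in at z. (\<zeta> - z) * q \<zeta> - c \<noteq> 0"
    using \<open>c \<noteq> 0\<close> unfolding isCont_def by (intro tendsto_imp_eventually_ne[where c = "- c"]) auto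
  then have "\<forall>\<^sub>F \<zeta> in at z. (\<zeta> - z) * q \<zeta> - c \<noteq> 0 \<and> \<zeta> \<in> U"
    using eventually_at_in_open'[OF assms(1,2)] by eventually_elim auto
  then obtain d where d: "d > 0" "\<And>\<zeta>. \<zeta> \<noteq> z \<Longrightarrow> dist \<zeta> z < d \<Longrightarrow> (\<zeta> - z) * q \<zeta> - c \<noteq> 0 \<and> \<zeta> \<in> U"
    unfolding eventually_at by auto
  have "countable (insert z T)" using assms(4) by simp
  then have "\<not> ball z d \<subseteq> insert z T"
    using uncountable_ball[OF d(1), of z] countable_subset by blast
  then obtain \<zeta> where "\<zeta> \<in> ball z d" "\<zeta> \<noteq> z" "\<zeta> \<notin> T" by blast
  then show False using d(2)[of \<zeta>] eq[of \<zeta>] by (simp add: dist_commute)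
qed

section \<open>Anti-linear functionals and the topology of the test space\<close>

definition antilinear_X :: "(cfun \<Rightarrow> complex) \<Rightarrow> bool" where
  "antilinear_X \<mu> \<longleftrightarrow> (\<forall>f \<in> X. \<forall>g \<in> X. \<forall>a b :: complex.
     \<mu> (\<lambda>\<omega>. a * f \<omega> + b * g \<omega>) = cnj a * \<mu> f + cnj b * \<mu> g)"

lemma antilinear_XD:
  "antilinear_X \<mu> \<Longrightarrow> f \<in> X \<Longrightarrow> g \<in> X \<Longrightarrow>
    \<mu> (\<lambda>\<omega>. a * f \<omega> + b * g \<omega>) = cnj a * \<mu> f + cnj b * \<mu> g"
  unfolding antilinear_X_def by blast

lemma X_zero: "(\<lambda>_. 0) \<in> X"
  using test_span_zero test_span_subset_X by blast

lemma X_add: "f \<in> X \<Longrightarrow> g \<in> X \<Longrightarrow> (\<lambda>\<omega>. f \<omega> + g \<omega>) \<in> X"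
  using X_combination[of f g 1 1] by simp

lemma X_scale: "f \<in> X \<Longrightarrow> (\<lambda>\<omega>. c * f \<omega>) \<in> X"
  using X_combination[of f f c 0] by simp

lemma X_sum: "(\<And>x. x \<in> A \<Longrightarrow> f x \<in> X) \<Longrightarrow> (\<lambda>\<omega>. \<Sum>x\<in>A. f x \<omega>) \<in> X"
  by (induction A rule: infinite_finite_induct) (auto intro: X_zero X_add)

lemma antilinear_X_zero: "antilinear_X \<mu> \<Longrightarrow> \<mu> (\<lambda>_. 0) = 0"
  using antilinear_XD[of \<mu> "\<lambda>_. 0" "\<lambda>_. 0" 0 0] X_zero by simp

lemma antilinear_X_add:
  "antilinear_X \<mu> \<Longrightarrow> f \<in> X \<Longrightarrow> g \<in> X \<Longrightarrow> \<mu> (\<lambda>\<omega>. f \<omega> + g \<omega>) = \<mu> f + \<mu> g"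
  using antilinear_XD[of \<mu> f g 1 1] by simp

lemma antilinear_X_scale: "antilinear_X \<mu> \<Longrightarrow> f \<in> X \<Longrightarrow> \<mu> (\<lambda>\<omega>. c * f \<omega>) = cnj c * \<mu> f"
  using antilinear_XD[of \<mu> f f c 0] by simp

lemma antilinear_X_sum:
  assumes "antilinear_X \<mu>" "\<And>x. x \<in> A \<Longrightarrow> f x \<in> X"
  shows "\<mu> (\<lambda>\<omega>. \<Sum>x\<in>A. c x * f x \<omega>) = (\<Sum>x\<in>A. cnj (c x) * \<mu> (f x))"
  using assms(2)
proof (induction A rule: infinite_finite_induct)
  case (insert x A)
  have "(\<lambda>\<omega>. \<Sum>x\<in>A. c x * f x \<omega>) \<in> X"
    using insert by (intro X_sum X_scale) auto
  then have "\<mu> (\<lambda>\<omega>. c x * f x \<omega> + (\<Sum>x\<in>A. c x * f x \<omega>)) =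
      cnj (c x) * \<mu> (f x) + \<mu> (\<lambda>\<omega>. \<Sum>x\<in>A. c x * f x \<omega>)"
    using antilinear_X_add[OF assms(1) X_scale] antilinear_X_scale[OF assms(1)] insert.prems by simp
  then show ?case
    using insert by simp
qed (auto simp: antilinear_X_zero assms(1))

lemma X_dual_antilinear: "\<mu> \<in> X_dual M \<Longrightarrow> antilinear_X \<mu>"
  unfolding X_dual_def antilinear_X_def by blast

lemma basic_nbhd_X: "basic_nbhd M X"
  unfolding basic_nbhd_def using X_combination unfolding X_def by (auto intro: exI[of _ 1])

lemma openin_X_topology_X: "openin (X_topology M) X"
  unfolding openin_X_topology using basic_nbhd_X X_add by blast

lemma topspace_X_topology: "topspace (X_topology M) = X"
  using openin_X_topology_X openin_subset[of "X_topology M"]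
  by (metis openin_X_topology openin_topspace subset_antisym)

text \<open>Turns topological continuity into an epsilon-delta bound at each level: the preimage of
  a ball contains a basic neighbourhood of 0, whose trace on \<open>Xn n\<close> contains a norm
  ball.\<close>

lemma X_dual_bounded_near_0:
  assumes \<mu>: "\<mu> \<in> X_dual M" and e: "e > 0"
  obtains d where "d > 0" "\<And>f. f \<in> Xn n \<Longrightarrow> L2_norm M f < d \<Longrightarrow> cmod (\<mu> f) < e"
proof -
  let ?U = "{f \<in> X. \<mu> f \<in> ball 0 e}"
  have "continuous_map (X_topology M) euclidean \<mu>"
    using \<mu> unfolding X_dual_def by blast
  then have "openin (X_topology M) ?U"
    using openin_continuous_map_preimage[of "X_topology M" euclidean \<mu> "ball 0 e"]
    by (simp add: topspace_X_topology)
  moreover have "(\<lambda>_. 0) \<in> ?U"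
    using e X_zero antilinear_X_zero[OF X_dual_antilinear[OF \<mu>]] by simp
  ultimately obtain W where W: "basic_nbhd M W" "\<forall>w \<in> W. (\<lambda>\<omega>. 0 + w \<omega>) \<in> ?U"
    unfolding openin_X_topology by blast
  obtain d where d: "d > 0" "\<forall>f \<in> Xn n. L2_norm M f < d \<longrightarrow> f \<in> W"
    using W(1) unfolding basic_nbhd_def by blast
  have "cmod (\<mu> f) < e" if "f \<in> Xn n" "L2_norm M f < d" for f
    using W(2) d(2) that by auto
  then show ?thesis using that d(1) by blast
qed

section \<open>Eigenvector expansion of test functions\<close>

locale golden_eigensystem = golden_markov M for M +
  fixes \<Phi> :: "branch \<Rightarrow> nat \<Rightarrow> cfun" and \<Phi>' :: "branch \<Rightarrow> nat \<Rightarrow> cfun \<Rightarrow> complex"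
  assumes eigenvectors: "eigenvector_system M \<Phi>" and duals: "dual_system M \<Phi> \<Phi>'"
begin

lemma \<Phi>_in_X: "\<Phi> p n \<in> X"
  using eigenvectors unfolding eigenvector_system_def by blast

lemma \<Phi>_nonzero: "\<Phi> p n \<noteq> (\<lambda>_. 0)"
  using eigenvectors unfolding eigenvector_system_def by blast

lemma transfer_\<Phi>: "transfer (\<Phi> p n) \<omega> = eigval p n * \<Phi> p n \<omega>"
proof -
  have "pf_X M (\<Phi> p n) = (\<lambda>\<omega>. eigval p n * \<Phi> p n \<omega>)"
    using eigenvectors unfolding eigenvector_system_def by blast
  then show ?thesis using pf_X_eq_transfer[OF \<Phi>_in_X] by metis
qed

lemma \<Phi>'_in_dual: "\<Phi>' p n \<in> X_dual M"
  using duals unfolding dual_system_def by blast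

lemma \<Phi>'_antilinear: "antilinear_X (\<Phi>' p n)"
  by (rule X_dual_antilinear[OF \<Phi>'_in_dual])

lemma \<Phi>'_\<Phi>: "\<Phi>' p i (\<Phi> q j) = (if p = q \<and> i = j then 1 else 0)"
  using duals unfolding dual_system_def by auto

text \<open>By \<open>eigval_inj\<close> the eigenvalue with index \<open>k\<close> occurs in no
  diagonal block other than that of degree \<open>k\<close>. Starting from any degree bound,
  \<open>transfer_eigenvector_degree\<close> therefore lowers it step by step to
  \<open>Suc k\<close>.\<close>

lemma \<Phi>_in_test_span: "\<Phi> p k \<in> test_span (Suc k)"
proof -
  have descend: "\<Phi> p k \<in> test_span (Suc k)" if "\<Phi> p k \<in> test_span (Suc k + d)" for d
    using that
  proof (induction d)
    case (Suc d)
    have "\<Phi> p k \<in> test_span (Suc k + d)"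
    proof (rule transfer_eigenvector_degree[OF _ transfer_\<Phi>])
      show "\<Phi> p k \<in> test_span (Suc (Suc k + d))" using Suc.prems by simp
      show "eigval p k \<noteq> of_real (1 / golden ^ (Suc k + d))"
        using eigval_inj[of p k Plus "Suc k + d"] unfolding eigval_def[of Plus] by auto
      show "eigval p k \<noteq> - of_real (1 / golden ^ (Suc k + d + 2))"
        using eigval_inj[of p k Minus "Suc k + d"] unfolding eigval_def[of Minus] by auto
    qed
    then show ?case by (rule Suc.IH)
  qed simp
  obtain N where "\<Phi> p k \<in> test_span N" using \<Phi>_in_X by (rule X_obtain)
  then have "\<Phi> p k \<in> test_span (Suc k + N)"
    using test_span_mono[of N "Suc k + N"] by auto
  then show ?thesis by (rule descend)
qed

abbreviation idx :: "nat \<Rightarrow> (branch \<times> nat) set" where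
  "idx n \<equiv> UNIV \<times> {..<n}"

abbreviation ev :: "branch \<times> nat \<Rightarrow> cfun" where "ev b \<equiv> \<Phi> (fst b) (snd b)"
abbreviation dv :: "branch \<times> nat \<Rightarrow> cfun \<Rightarrow> complex" where "dv b \<equiv> \<Phi>' (fst b) (snd b)"
abbreviation lv :: "branch \<times> nat \<Rightarrow> complex" where "lv b \<equiv> eigval (fst b) (snd b)"

lemma dv_ev: "dv a (ev b) = (if a = b then 1 else 0)"
  by (simp add: \<Phi>'_\<Phi> prod_eq_iff)

lemma inj_ev: "inj ev"
proof (rule injI)
  fix a b assume "ev a = ev b"
  then have "dv a (ev b) = 1" using dv_ev[of a a] by simp
  then show "a = b" by (simp add: dv_ev split: if_splits)
qed

lemma ev_in_test_span: assumes "b \<in> idx n" shows "ev b \<in> test_span n"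
proof -
  have "Suc (snd b) \<le> n" using assms by auto
  then show ?thesis using \<Phi>_in_test_span test_span_mono by blast
qed

text \<open>Applying \<open>dv b\<close> to a vanishing combination isolates the conjugate of the
  coefficient of \<open>ev b\<close>.\<close>

lemma independent_ev: assumes "finite B" shows "cfun.independent (ev ` B)"
proof (rule cfun.independent_if_scalars_zero)
  show "finite (ev ` B)" using assms by simp
  fix u x assume zero: "(\<Sum>x\<in>ev ` B. (\<lambda>\<omega>. u x * x \<omega>)) = 0" and "x \<in> ev ` B"
  then obtain b where b: "b \<in> B" "x = ev b" by blast
  have "(\<lambda>\<omega>. \<Sum>c\<in>B. u (ev c) * ev c \<omega>) = (\<lambda>_. 0)"
  proof
    fix \<omega>
    have "(\<Sum>x\<in>ev ` B. (\<lambda>\<omega>. u x * x \<omega>)) \<omega> = 0" unfolding zero by simp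
    then show "(\<Sum>c\<in>B. u (ev c) * ev c \<omega>) = 0"
      using inj_on_subset[OF inj_ev] by (simp add: sum_fun_apply sum.reindex)
  qed
  then have "0 = dv b (\<lambda>\<omega>. \<Sum>c\<in>B. u (ev c) * ev c \<omega>)"
    by (simp add: antilinear_X_zero[OF \<Phi>'_antilinear])
  also have "\<dots> = (\<Sum>c\<in>B. cnj (u (ev c)) * dv b (ev c))"
    by (rule antilinear_X_sum[OF \<Phi>'_antilinear \<Phi>_in_X])
  also have "\<dots> = cnj (u (ev b))"
    using b assms by (simp add: dv_ev if_distrib cong: if_cong)
  finally show "u x = 0" using b by simp
qed

text \<open>The dual system makes the \<open>2 n\<close> eigenvectors on the right independent, and the left side is
  spanned by \<open>2 n\<close> test functions.\<close>

lemma test_span_subset_span_ev: "test_span n \<subseteq> cfun.span (ev ` idx n)"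
proof
  fix f assume f: "f \<in> test_span n"
  let ?T = "(\<lambda>(j, i). test_fun j i) ` ({0, 1} \<times> {..<n})"
  have sub: "ev ` idx n \<subseteq> test_span n"
    using ev_in_test_span by blast
  have "card (idx n) = 2 * n" by (simp add: card_cartesian_product UNIV_branch)
  then have card: "card (ev ` idx n) = 2 * n"
    using card_image[OF inj_on_subset[OF inj_ev]] by simp
  have cardT: "card ?T \<le> 2 * n"
    using card_image_le[of "{0, 1} \<times> {..<n}" "\<lambda>(j, i). test_fun j i"] by simp
  show "f \<in> cfun.span (ev ` idx n)"
  proof (rule ccontr)
    assume no: "f \<notin> cfun.span (ev ` idx n)"
    \<comment> \<open>Adjoining \<open>f\<close> would produce \<open>2 * n + 1\<close> independent
      vectors in the span of at most \<open>2 * n\<close>.\<close>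
    then have "cfun.independent (insert f (ev ` idx n))"
      by (intro cfun.independent_insertI independent_ev) auto
    moreover have "insert f (ev ` idx n) \<subseteq> cfun.span ?T"
      using f sub unfolding test_span_def by blast
    ultimately have "card (insert f (ev ` idx n)) \<le> card ?T"
      using cfun.independent_span_bound[of ?T] by blast
    moreover have "f \<notin> ev ` idx n" using no by (rule contrapos_nn) (rule cfun.span_base)
    ultimately show False using card cardT by simp
  qed
qed

text \<open>On the eigenvectors both claims are biorthogonality, and both survive linear
  combinations. The conjugates make the coefficients linear in \<open>f\<close>, since
  \<open>dv b\<close> is anti-linear. The vanishing beyond the degree bound is what makes every
  later series terminate on a given \<open>f\<close>.\<close>

lemma
  assumes f: "f \<in> test_span n"
  shows expansion: "f \<omega> = (\<Sum>b\<in>idx n. cnj (dv b f) * ev b \<omega>)"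
    and dv_eq_0: "snd b \<ge> n \<Longrightarrow> dv b f = 0"
proof -
  \<comment> \<open>Membership in \<open>X\<close> is carried along because anti-linearity of
    \<open>dv b\<close> is available on \<open>X\<close> only.\<close>
  let ?V = "{f \<in> X. (\<forall>\<omega>. f \<omega> = (\<Sum>b\<in>idx n. cnj (dv b f) * ev b \<omega>)) \<and> (\<forall>b. snd b \<ge> n \<longrightarrow> dv b f = 0)}"
  have "cfun.span (ev ` idx n) \<subseteq> ?V"
  proof (intro cfun.span_minimal cfun_subspaceI)
    show "ev ` idx n \<subseteq> ?V"
    proof (intro image_subsetI CollectI conjI allI impI)
      fix a \<omega> assume "a \<in> idx n"
      then show "ev a \<omega> = (\<Sum>b\<in>idx n. cnj (dv b (ev a)) * ev b \<omega>)"
        unfolding dv_ev by (simp add: if_distrib[of cnj] if_distrib[of "\<lambda>x. x * _"] cong: if_cong)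
    next
      fix a b :: "branch \<times> nat" assume "a \<in> idx n" "snd b \<ge> n"
      then show "dv b (ev a) = 0"
        unfolding dv_ev by auto
    qed (rule \<Phi>_in_X)
    show "(\<lambda>_. 0) \<in> ?V"
      by (simp add: X_zero antilinear_X_zero \<Phi>'_antilinear)
  next
    fix f g assume f: "f \<in> ?V" and g: "g \<in> ?V"
    then have dv: "dv b (\<lambda>\<omega>. f \<omega> + g \<omega>) = dv b f + dv b g" for b
      by (intro antilinear_X_add \<Phi>'_antilinear) blast+
    show "(\<lambda>\<omega>. f \<omega> + g \<omega>) \<in> ?V"
    proof (intro CollectI conjI allI impI)
      show "f \<omega> + g \<omega> = (\<Sum>b\<in>idx n. cnj (dv b (\<lambda>\<omega>. f \<omega> + g \<omega>)) * ev b \<omega>)" for \<omega>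
      proof -
        have "f \<omega> = (\<Sum>b\<in>idx n. cnj (dv b f) * ev b \<omega>)" "g \<omega> = (\<Sum>b\<in>idx n. cnj (dv b g) * ev b \<omega>)"
          using f g by blast+
        then show ?thesis unfolding dv by (simp add: distrib_right sum.distrib)
      qed
      show "(\<lambda>\<omega>. f \<omega> + g \<omega>) \<in> X" using f g X_add by blast
      show "dv b (\<lambda>\<omega>. f \<omega> + g \<omega>) = 0" if "n \<le> snd b" for b
      proof -
        have "dv b f = 0" "dv b g = 0" using f g that by blast+
        then show ?thesis unfolding dv by simp
      qed
    qed
  next
    fix c f assume f: "f \<in> ?V"
    then have dv: "dv b (\<lambda>\<omega>. c * f \<omega>) = cnj c * dv b f" for b
      by (intro antilinear_X_scale \<Phi>'_antilinear) blast
    show "(\<lambda>\<omega>. c * f \<omega>) \<in> ?V"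
    proof (intro CollectI conjI allI impI)
      show "c * f \<omega> = (\<Sum>b\<in>idx n. cnj (dv b (\<lambda>\<omega>. c * f \<omega>)) * ev b \<omega>)" for \<omega>
      proof -
        have "f \<omega> = (\<Sum>b\<in>idx n. cnj (dv b f) * ev b \<omega>)"
          using f by blast
        then show ?thesis unfolding dv by (simp add: sum_distrib_left mult.assoc)
      qed
      show "(\<lambda>\<omega>. c * f \<omega>) \<in> X" using f X_scale by blast
      show "dv b (\<lambda>\<omega>. c * f \<omega>) = 0" if "n \<le> snd b" for b
      proof -
        have "dv b f = 0" using f that by blast
        then show ?thesis unfolding dv by simp
      qed
    qed
  qed
  then have "f \<in> ?V" using f test_span_subset_span_ev by blast
  then show "f \<omega> = (\<Sum>b\<in>idx n. cnj (dv b f) * ev b \<omega>)" "snd b \<ge> n \<Longrightarrow> dv b f = 0" by auto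
qed

text \<open>On \<open>Xn n\<close> such a functional is a finite combination of the \<open>\<Phi>'\<close>, which are continuous by
  assumption.\<close>

lemma antilinear_in_X_dual:
  assumes \<mu>: "antilinear_X \<mu>" and ext: "\<mu> \<in> extensional X"
  shows "\<mu> \<in> X_dual M"
proof -
  have small: "\<exists>d>0. \<forall>f \<in> Xn n. L2_norm M f < d \<longrightarrow> cmod (\<mu> f) < e" if e: "e > 0" for n e
  proof -
    \<comment> \<open>The summand 1 ensures \<open>C > 0\<close> and makes the final estimate
      \<open>e / C * (C - 1) < e\<close> strict.\<close>
    define C where "C = (\<Sum>b\<in>idx (Suc n). cmod (\<mu> (ev b))) + 1"
    have "C > 0" unfolding C_def by (intro add_nonneg_pos sum_nonneg) auto
    then have "e / C > 0" using e by simp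
    then have "\<exists>d>0. \<forall>f \<in> Xn n. L2_norm M f < d \<longrightarrow> cmod (dv b f) < e / C" for b
      using X_dual_bounded_near_0[OF \<Phi>'_in_dual] by metis
    then obtain D where D: "\<And>b. D b > 0"
      "\<And>b f. f \<in> Xn n \<Longrightarrow> L2_norm M f < D b \<Longrightarrow> cmod (dv b f) < e / C"
      by metis
    define d where "d = Min (D ` idx (Suc n))"
    have "d > 0" unfolding d_def using D(1) by (subst Min_gr_iff) auto
    moreover have "cmod (\<mu> f) < e" if f: "f \<in> Xn n" "L2_norm M f < d" for f
    proof -
      have "f = (\<lambda>\<omega>. \<Sum>b\<in>idx (Suc n). cnj (dv b f) * ev b \<omega>)"
        using expansion f(1) unfolding Xn_eq_test_span by blast
      then have "\<mu> f = \<mu> (\<lambda>\<omega>. \<Sum>b\<in>idx (Suc n). cnj (dv b f) * ev b \<omega>)" by simp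
      also have "\<dots> = (\<Sum>b\<in>idx (Suc n). cnj (cnj (dv b f)) * \<mu> (ev b))"
        by (rule antilinear_X_sum[OF \<mu> \<Phi>_in_X])
      also have "cmod \<dots> \<le> (\<Sum>b\<in>idx (Suc n). e / C * cmod (\<mu> (ev b)))"
      proof (intro sum_norm_le)
        fix b assume "b \<in> idx (Suc n)"
        then have "d \<le> D b" unfolding d_def by (intro Min_le) auto
        then have "cmod (dv b f) < e / C" using D(2) f by simp
        then show "norm (cnj (cnj (dv b f)) * \<mu> (ev b)) \<le> e / C * cmod (\<mu> (ev b))"
          unfolding norm_mult complex_mod_cnj by (intro mult_right_mono) auto
      qed
      also have "\<dots> = e / C * (C - 1)"
        unfolding C_def by (simp add: sum_distrib_left)
      also have "\<dots> < e" using e \<open>C > 0\<close> by (simp add: field_simps)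
      finally show ?thesis .
    qed
    ultimately show ?thesis by blast
  qed
  have "continuous_map (X_topology M) euclidean \<mu>"
    unfolding continuous_map topspace_X_topology
  proof (intro conjI allI impI)
    fix U :: "complex set" assume "openin euclidean U"
    then have U: "open U" by simp
    show "openin (X_topology M) {f \<in> X. \<mu> f \<in> U}"
      unfolding openin_X_topology
    proof (intro conjI ballI)
      fix f assume "f \<in> {f \<in> X. \<mu> f \<in> U}"
      then have f: "f \<in> X" "\<mu> f \<in> U" by auto
      then obtain e where e: "e > 0" "ball (\<mu> f) e \<subseteq> U"
        using U open_contains_ball by blast
      \<comment> \<open>A sublevel set of the modulus of an anti-linear functional is absolutely
        convex. By \<open>small\<close> it contains a norm ball of each \<open>Xn n\<close>, with a
        radius that may depend on \<open>n\<close>, as \<open>basic_nbhd\<close> permits.\<close>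
      let ?W = "{w \<in> X. cmod (\<mu> w) < e}"
      have "basic_nbhd M ?W"
        unfolding basic_nbhd_def
      proof (intro conjI ballI allI impI)
        fix v w and a b :: complex assume *: "v \<in> ?W" "w \<in> ?W" "cmod a + cmod b \<le> 1"
        then have vw: "(\<lambda>\<omega>. a * v \<omega> + b * w \<omega>) \<in> X" by (auto intro: X_combination)
        define m where "m = max (cmod (\<mu> v)) (cmod (\<mu> w))"
        have "cmod (\<mu> (\<lambda>\<omega>. a * v \<omega> + b * w \<omega>)) \<le> cmod a * cmod (\<mu> v) + cmod b * cmod (\<mu> w)"
          using * norm_triangle_ineq[of "cnj a * \<mu> v" "cnj b * \<mu> w"]
          by (simp add: antilinear_XD[OF \<mu>] norm_mult)
        also have "\<dots> \<le> cmod a * m + cmod b * m"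
          unfolding m_def by (intro add_mono mult_left_mono) auto
        also have "\<dots> = (cmod a + cmod b) * m" by (simp add: distrib_right)
        also have "\<dots> \<le> 1 * m" using *(3) unfolding m_def by (intro mult_right_mono) (auto simp: le_max_iff_disj)
        also have "\<dots> < e" using * unfolding m_def by simp
        finally show "(\<lambda>\<omega>. a * v \<omega> + b * w \<omega>) \<in> ?W" using vw by simp
      next
        fix n show "\<exists>e>0. \<forall>f \<in> Xn n. L2_norm M f < e \<longrightarrow> f \<in> ?W"
          using small[OF e(1), of n] unfolding X_def by blast
      qed auto
      moreover have "(\<lambda>\<omega>. f \<omega> + w \<omega>) \<in> {f \<in> X. \<mu> f \<in> U}" if "w \<in> ?W" for w
      proof -
        have "\<mu> (\<lambda>\<omega>. f \<omega> + w \<omega>) \<in> ball (\<mu> f) e"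
          using that f(1) by (simp add: antilinear_X_add[OF \<mu>] dist_norm)
        then show ?thesis using e(2) that f(1) X_add by blast
      qed
      ultimately show "\<exists>W. basic_nbhd M W \<and> (\<forall>w \<in> W. (\<lambda>\<omega>. f \<omega> + w \<omega>) \<in> {f \<in> X. \<mu> f \<in> U})"
        by blast
    qed auto
  qed auto
  then show ?thesis
    using \<mu> ext unfolding X_dual_def antilinear_X_def by blast
qed

end

section \<open>Spectral decomposition and generalized resolvent\<close>

lemma transfer_sum:
  "transfer (\<lambda>\<omega>. \<Sum>x\<in>A. c x * f x \<omega>) \<omega> = (\<Sum>x\<in>A. c x * transfer (f x) \<omega>)"
proof (induction A rule: infinite_finite_induct)
  case (insert x A)
  have "transfer (\<lambda>\<omega>. c x * f x \<omega> + (\<Sum>x\<in>A. c x * f x \<omega>)) \<omega> =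
      c x * transfer (f x) \<omega> + transfer (\<lambda>\<omega>. \<Sum>x\<in>A. c x * f x \<omega>) \<omega>"
    unfolding transfer_add transfer_scale ..
  then show ?case using insert by simp
qed (simp_all add: transfer_def)

lemma sum_lessThan_trunc:
  fixes h :: "nat \<Rightarrow> 'a :: comm_monoid_add"
  assumes "\<And>n. n \<ge> m \<Longrightarrow> h n = 0" "N \<ge> m"
  shows "(\<Sum>n<N. h n) = (\<Sum>n<m. h n)"
  using assms by (intro sum.mono_neutral_right) auto

context golden_markov
begin

lemma antilinear_L2_inner: assumes "g \<in> L2 M" shows "antilinear_X (L2_inner M g)"
  unfolding antilinear_X_def using L2_inner_combination_right X_subset_L2 assms by blast

lemma L2_inner_sum_left:
  assumes "g \<in> X" "\<And>x. x \<in> A \<Longrightarrow> f x \<in> X"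
  shows "L2_inner M (\<lambda>\<omega>. \<Sum>x\<in>A. c x * f x \<omega>) g = (\<Sum>x\<in>A. c x * L2_inner M (f x) g)"
proof -
  have "antilinear_X (L2_inner M g)" using antilinear_L2_inner X_subset_L2 assms(1) by blast
  then have "L2_inner M g (\<lambda>\<omega>. \<Sum>x\<in>A. c x * f x \<omega>) = (\<Sum>x\<in>A. cnj (c x) * L2_inner M g (f x))"
    by (rule antilinear_X_sum) (rule assms(2))
  then have "cnj (L2_inner M g (\<lambda>\<omega>. \<Sum>x\<in>A. c x * f x \<omega>)) = (\<Sum>x\<in>A. c x * cnj (L2_inner M g (f x)))"
    by simp
  then show ?thesis by (simp flip: L2_inner_cnj)
qed

lemma L2_inner_X_nonzero: assumes "f \<in> X" "f \<noteq> (\<lambda>_. 0)" shows "L2_inner M f f \<noteq> 0"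
proof
  assume "L2_inner M f f = 0"
  then have "AE \<omega> in M. f \<omega> = 0"
    using assms(1) X_subset_L2 by (intro L2_self_integral_eq_0) (auto simp: L2_inner_self)
  then show False using X_AE_eq_0 assms by blast
qed

lemma L2_embed_antilinear: assumes "g \<in> L2 M" shows "antilinear_X (L2_embed M g)"
  using antilinear_L2_inner[OF assms] X_combination
  unfolding antilinear_X_def L2_embed_def by simp

lemma L2_embed_cong_AE:
  assumes "g \<in> L2 M" "h \<in> L2 M" "AE \<omega> in M. g \<omega> = h \<omega>"
  shows "L2_embed M g = L2_embed M h"
  unfolding L2_embed_def
proof (rule restrict_ext)
  fix f assume "f \<in> X"
  then show "L2_inner M g f = L2_inner M h f"
    using L2_inner_cong_AE[OF assms(1,2) _ assms(3)] X_subset_L2 by blast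
qed

end

section \<open>Diagonal form of the transfer operator and of its resolvent\<close>

context golden_eigensystem
begin

lemma sum_idx: "(\<Sum>b\<in>idx N. h b) = (\<Sum>n<N. h (Plus, n)) + (\<Sum>n<N. h (Minus, n))"
proof -
  have "(\<Sum>b\<in>idx N. h b) = (\<Sum>p\<in>UNIV. \<Sum>n<N. h (p, n))"
    by (simp add: sum.cartesian_product)
  then show ?thesis by (simp add: UNIV_branch)
qed

text \<open>For \<open>f \<in> X\<close> the sum is finite, although its range depends on \<open>f\<close>.\<close>

definition diagonal :: "(branch \<times> nat \<Rightarrow> complex) \<Rightarrow> cfun \<Rightarrow> cfun" where
  "diagonal c f = (\<lambda>\<omega>. \<Sum>b | dv b f \<noteq> 0. (c b * cnj (dv b f)) * ev b \<omega>)"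

lemma diagonal_eq:
  assumes "f \<in> test_span n"
  shows "diagonal c f = (\<lambda>\<omega>. \<Sum>b\<in>idx n. (c b * cnj (dv b f)) * ev b \<omega>)"
proof
  fix \<omega>
  have "{b. dv b f \<noteq> 0} \<subseteq> idx n"
    using dv_eq_0[OF assms] by (force simp: not_le[symmetric])
  then show "diagonal c f \<omega> = (\<Sum>b\<in>idx n. (c b * cnj (dv b f)) * ev b \<omega>)"
    unfolding diagonal_def by (intro sum.mono_neutral_left) auto
qed

lemma diagonal_in_test_span: "f \<in> test_span n \<Longrightarrow> diagonal c f \<in> test_span n"
  unfolding diagonal_eq by (intro test_span_sum test_span_scale ev_in_test_span)

lemma diagonal_in_X: "f \<in> X \<Longrightarrow> diagonal c f \<in> X"
  using diagonal_in_test_span unfolding X_eq_test_span by blast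

lemma transfer_eq_diagonal: assumes "f \<in> X" shows "transfer f = diagonal lv f"
proof -
  obtain n where n: "f \<in> test_span n" using assms by (rule X_obtain)
  have "f = (\<lambda>\<omega>. \<Sum>b\<in>idx n. cnj (dv b f) * ev b \<omega>)" using expansion[OF n] by blast
  then have "transfer f = transfer (\<lambda>\<omega>. \<Sum>b\<in>idx n. cnj (dv b f) * ev b \<omega>)" by simp
  also have "\<dots> = diagonal lv f"
    unfolding diagonal_eq[OF n] by (rule ext) (unfold transfer_sum transfer_\<Phi>, simp add: ac_simps)
  finally show ?thesis .
qed

text \<open>Dividing the coefficient of \<open>ev b\<close> by \<open>\<zeta> - lv b\<close> inverts
  \<open>\<zeta> - transfer\<close> on that eigenvector. The equation holds pointwise and also for
  \<open>\<zeta>\<close> inside the unit disc.\<close>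

lemma diagonal_resolvent:
  assumes \<zeta>: "\<zeta> \<notin> eigvals" and f: "f \<in> X"
  defines "g \<equiv> diagonal (\<lambda>b. 1 / (\<zeta> - lv b)) f"
  shows "\<zeta> * g \<omega> - transfer g \<omega> = f \<omega>"
proof -
  obtain n where n: "f \<in> test_span n" using f by (rule X_obtain)
  have ne: "\<zeta> - lv b \<noteq> 0" for b using \<zeta> unfolding eigvals_def by auto
  let ?c = "\<lambda>b. 1 / (\<zeta> - lv b) * cnj (dv b f)"
  have g: "g = (\<lambda>\<omega>. \<Sum>b\<in>idx n. ?c b * ev b \<omega>)"
    unfolding g_def by (rule diagonal_eq[OF n])
  have "\<zeta> * g \<omega> - transfer g \<omega> = (\<Sum>b\<in>idx n. \<zeta> * (?c b * ev b \<omega>) - ?c b * (lv b * ev b \<omega>))"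
    unfolding g transfer_sum transfer_\<Phi> sum_subtractf sum_distrib_left ..
  also have "\<dots> = (\<Sum>b\<in>idx n. cnj (dv b f) * ev b \<omega>)"
  proof (intro sum.cong refl)
    fix b
    have *: "x * (1 / (x - l) * k * e) - 1 / (x - l) * k * (l * e) = k * e"
      if "x - l \<noteq> 0" for x l k e :: complex
    proof -
      define d where "d = x - l"
      have "x = d + l" "d \<noteq> 0" using that unfolding d_def by auto
      then show ?thesis by (simp add: field_simps)
    qed
    show "\<zeta> * (?c b * ev b \<omega>) - ?c b * (lv b * ev b \<omega>) = cnj (dv b f) * ev b \<omega>"
      by (rule *[OF ne])
  qed
  also have "\<dots> = f \<omega>" by (rule expansion[OF n, symmetric])
  finally show ?thesis .
qed

text \<open>The candidate for the continuation. At an eigenvalue the offending coefficient is 0 by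
  the convention for division, so the values lie in the dual everywhere; holomorphy is claimed only
  off \<open>insert 0 eigvals\<close>.\<close>

definition diag_resolvent :: "complex \<Rightarrow> cfun \<Rightarrow> (cfun \<Rightarrow> complex)" where
  "diag_resolvent \<zeta> f = L2_embed M (diagonal (\<lambda>b. 1 / (\<zeta> - lv b)) f)"

lemma diag_resolvent_apply:
  assumes "f \<in> test_span n" "g \<in> X"
  shows "diag_resolvent \<zeta> f g = (\<Sum>b\<in>idx n. (1 / (\<zeta> - lv b) * cnj (dv b f)) * L2_inner M (ev b) g)"
proof -
  have "diag_resolvent \<zeta> f g = L2_inner M (\<lambda>\<omega>. \<Sum>b\<in>idx n. (1 / (\<zeta> - lv b) * cnj (dv b f)) * ev b \<omega>) g"
    unfolding diag_resolvent_def diagonal_eq[OF assms(1)] L2_embed_def using assms(2) by simp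
  also have "\<dots> = (\<Sum>b\<in>idx n. (1 / (\<zeta> - lv b) * cnj (dv b f)) * L2_inner M (ev b) g)"
    by (rule L2_inner_sum_left[OF assms(2) \<Phi>_in_X])
  finally show ?thesis .
qed

lemma diag_resolvent_ev: "g \<in> X \<Longrightarrow> diag_resolvent \<zeta> (ev a) g = L2_inner M (ev a) g / (\<zeta> - lv a)"
proof -
  assume g: "g \<in> X"
  have a: "a \<in> idx (Suc (snd a))" by (cases a) auto
  have "diag_resolvent \<zeta> (ev a) g =
      (\<Sum>b\<in>idx (Suc (snd a)). if b = a then L2_inner M (ev a) g / (\<zeta> - lv a) else 0)"
    unfolding diag_resolvent_apply[OF ev_in_test_span[OF a] g] dv_ev by (intro sum.cong) auto
  then show ?thesis using a by simp
qed

lemma diag_resolvent_in_X_dual: assumes "f \<in> X" shows "diag_resolvent \<zeta> f \<in> X_dual M"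
proof (rule antilinear_in_X_dual)
  show "antilinear_X (diag_resolvent \<zeta> f)"
    unfolding diag_resolvent_def using diagonal_in_X[OF assms] X_subset_L2 by (intro L2_embed_antilinear) blast
  show "diag_resolvent \<zeta> f \<in> extensional X" unfolding diag_resolvent_def L2_embed_def by simp
qed

lemma diag_resolvent_holomorphic: "weakstar_holomorphic M diag_resolvent (- insert 0 eigvals)"
  unfolding weakstar_holomorphic_def
proof (intro conjI ballI diag_resolvent_in_X_dual)
  fix f g assume f: "f \<in> X" and g: "g \<in> X"
  obtain n where n: "f \<in> test_span n" using f by (rule X_obtain)
  show "(\<lambda>\<zeta>. diag_resolvent \<zeta> f g) holomorphic_on - insert 0 eigvals"
    unfolding diag_resolvent_apply[OF n g]
    by (intro holomorphic_intros) (auto simp: eigvals_def)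
qed

lemma diag_resolvent_linear:
  assumes "f \<in> X" "g \<in> X" "x \<in> X"
  shows "diag_resolvent \<zeta> (\<lambda>\<omega>. a * f \<omega> + b * g \<omega>) x = a * diag_resolvent \<zeta> f x + b * diag_resolvent \<zeta> g x"
proof -
  obtain n where n: "f \<in> test_span n" "g \<in> test_span n" using assms(1,2) by (rule X_obtain2)
  then have n': "(\<lambda>\<omega>. a * f \<omega> + b * g \<omega>) \<in> test_span n" by (intro test_span_add test_span_scale)
  have dv: "dv i (\<lambda>\<omega>. a * f \<omega> + b * g \<omega>) = cnj a * dv i f + cnj b * dv i g" for i
    by (rule antilinear_XD[OF \<Phi>'_antilinear assms(1,2)])
  show ?thesis
    unfolding diag_resolvent_apply[OF n(1) assms(3)] diag_resolvent_apply[OF n(2) assms(3)] diag_resolvent_apply[OF n' assms(3)] dv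
      sum_distrib_left sum.distrib[symmetric]
    by (intro sum.cong) (simp_all add: algebra_simps add_divide_distrib)
qed

lemma eigvals_subset: "insert 0 eigvals \<subseteq> cball 0 1"
  unfolding eigvals_def using norm_eigval_le_1 by auto

lemma diag_resolvent_eq_resolvent:
  assumes \<zeta>: "1 < cmod \<zeta>" and f: "f \<in> X"
  shows "diag_resolvent \<zeta> f = L2_embed M (L2_resolvent M \<zeta> f)"
proof -
  let ?g = "diagonal (\<lambda>b. 1 / (\<zeta> - lv b)) f"
  have g: "?g \<in> L2 M" using diagonal_in_X[OF f] X_subset_L2 by blast
  have "\<zeta> \<notin> eigvals" using \<zeta> eigvals_subset by auto
  then have eq: "AE \<omega> in M. \<zeta> * ?g \<omega> - transfer ?g \<omega> = f \<omega>"
    by (simp add: diagonal_resolvent f)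
  have "AE \<omega> in M. ?g \<omega> = L2_resolvent M \<zeta> f \<omega>"
    using L2_resolvent_AE[OF \<zeta> g eq] by eventually_elim simp
  then show ?thesis
    unfolding diag_resolvent_def by (intro L2_embed_cong_AE g L2_resolvent_L2[OF \<zeta> g eq])
qed

section \<open>The generalized spectrum: singularities and uniqueness\<close>

lemma diag_resolvent_no_extension:
  assumes "open U" "lv a \<in> U" "q holomorphic_on U" "countable T" "eigvals \<subseteq> T"
    and eq: "\<And>\<zeta>. \<zeta> \<in> U - T \<Longrightarrow> q \<zeta> = diag_resolvent \<zeta> (ev a) (ev a)"
  shows False
proof -
  have "(\<zeta> - lv a) * q \<zeta> = L2_inner M (ev a) (ev a)" if "\<zeta> \<in> U - T" for \<zeta>
  proof -
    have "\<zeta> \<noteq> lv a" using that assms(5) unfolding eigvals_def by force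
    then show ?thesis using eq[OF that] by (simp add: diag_resolvent_ev \<Phi>_in_X)
  qed
  then have "L2_inner M (ev a) (ev a) = 0"
    by (rule no_simple_pole[OF assms(1-4)])
  then show False using L2_inner_X_nonzero \<Phi>_in_X \<Phi>_nonzero by blast
qed

text \<open>Reduces the point 0 to an eigenvalue. No single function
  \<open>\<lambda>\<zeta>. diag_resolvent \<zeta> f g\<close> is singular at 0; the obstruction
  there comes from the eigenvalues inside whatever common neighbourhood is proposed.\<close>

lemma eigval_in_open:
  assumes "open U" "z \<in> U" "z \<in> insert 0 eigvals" obtains a where "lv a \<in> U"
proof (cases "z = 0")
  case True
  then obtain r where "r > 0" and "ball 0 r \<subseteq> U" using assms open_contains_ball by blast
  moreover obtain n where "eigval Plus n \<in> ball 0 r" using eigval_near_0[OF \<open>r > 0\<close>] by blast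
  ultimately show ?thesis using that[of "(Plus, n)"] by auto
next
  case False
  then obtain p n where "z = eigval p n" using assms(3) unfolding eigvals_def by auto
  then show ?thesis using that[of "(p, n)"] assms(2) by simp
qed

lemma diag_resolvent_generalized_resolvent: "generalized_resolvent M (insert 0 eigvals) diag_resolvent"
  unfolding generalized_resolvent_def
proof (intro conjI ballI allI impI)
  show "connected (- insert 0 eigvals)"
    by (intro path_connected_imp_connected path_connected_complement_countable countable_eigvals) simp
  fix z assume z: "z \<in> insert 0 eigvals"
  show "\<not> removable_at M (insert 0 eigvals) diag_resolvent z"
  proof
    assume "removable_at M (insert 0 eigvals) diag_resolvent z"
    then obtain r Q where r: "r > 0" and Q: "weakstar_holomorphic M Q (ball z r)"
      and eq: "\<And>\<zeta> f. \<zeta> \<in> ball z r - insert 0 eigvals \<Longrightarrow> f \<in> X \<Longrightarrow> Q \<zeta> f = diag_resolvent \<zeta> f"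
      unfolding removable_at_def by blast
    obtain a where a: "lv a \<in> ball z r"
      using eigval_in_open[OF open_ball _ z] r centre_in_ball by blast
    show False
    proof (rule diag_resolvent_no_extension[OF open_ball a _ countable_eigvals])
      show "(\<lambda>\<zeta>. Q \<zeta> (ev a) (ev a)) holomorphic_on ball z r"
        using Q \<Phi>_in_X unfolding weakstar_holomorphic_def by blast
    qed (use eq \<Phi>_in_X in auto)
  qed
qed (use eigvals_subset closed_eigvals interior_countable[OF countable_eigvals] diag_resolvent_holomorphic
      diag_resolvent_linear diag_resolvent_eq_resolvent in \<open>simp_all\<close>)

lemma
  assumes "generalized_resolvent M Z R"
  shows generalized_spectrum_unique: "Z = insert 0 eigvals"
    and generalized_resolvent_unique: "\<zeta> \<in> - Z \<Longrightarrow> f \<in> X \<Longrightarrow> R \<zeta> f = diag_resolvent \<zeta> f"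
proof -
  let ?Z0 = "insert 0 eigvals"
  have Z: "Z \<subseteq> cball 0 1" "closed Z" "connected (- Z)" and R: "weakstar_holomorphic M R (- Z)"
    and res: "\<And>\<zeta> f. 1 < cmod \<zeta> \<Longrightarrow> f \<in> X \<Longrightarrow> R \<zeta> f = L2_embed M (L2_resolvent M \<zeta> f)"
    and sing: "\<And>z. z \<in> Z \<Longrightarrow> \<not> removable_at M Z R z"
    using assms unfolding generalized_resolvent_def by blast+
  \<comment> \<open>The spectra are not yet known to coincide, so both are removed before continuing
    from the exterior of the unit disc.\<close>
  have agree: "R \<zeta> f = diag_resolvent \<zeta> f" if \<zeta>: "\<zeta> \<in> - Z - ?Z0" and f: "f \<in> X" for \<zeta> f
  proof (rule extensionalityI[of _ X])
    show "R \<zeta> f \<in> extensional X"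
      using R \<zeta> f unfolding weakstar_holomorphic_def X_dual_def by blast
    show "diag_resolvent \<zeta> f \<in> extensional X"
      using diag_resolvent_in_X_dual[OF f] unfolding X_dual_def by blast
    fix g assume g: "g \<in> X"
    show "R \<zeta> f g = diag_resolvent \<zeta> f g"
    proof (rule analytic_continuation_open[where s = "{\<zeta>. 1 < cmod \<zeta>}" and s' = "- Z - ?Z0"
          and f = "\<lambda>\<zeta>. R \<zeta> f g" and g = "\<lambda>\<zeta>. diag_resolvent \<zeta> f g"])
      show "open {\<zeta> :: complex. 1 < cmod \<zeta>}"
        by (intro open_Collect_less continuous_intros)
      have "(2 :: complex) \<in> {\<zeta>. 1 < cmod \<zeta>}" by simp
      then show "{\<zeta> :: complex. 1 < cmod \<zeta>} \<noteq> {}" by blast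
      show "open (- Z - ?Z0)" using Z(2) closed_eigvals by (intro open_Diff) auto
      show "connected (- Z - ?Z0)"
        using Z(2,3) countable_eigvals by (intro connected_open_diff_countable) auto
      show "{\<zeta>. 1 < cmod \<zeta>} \<subseteq> - Z - ?Z0"
        using Z(1) eigvals_subset by fastforce
      show "(\<lambda>\<zeta>. R \<zeta> f g) holomorphic_on - Z - ?Z0"
        using R f g unfolding weakstar_holomorphic_def
        by (meson Diff_subset holomorphic_on_subset)
      show "(\<lambda>\<zeta>. diag_resolvent \<zeta> f g) holomorphic_on - Z - ?Z0"
        by (rule holomorphic_on_subset[of _ "- ?Z0"])
          (use diag_resolvent_holomorphic f g in \<open>auto simp: weakstar_holomorphic_def\<close>)
      show "\<zeta> \<in> - Z - ?Z0" by (rule \<zeta>)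
      fix z assume "z \<in> {\<zeta>. 1 < cmod \<zeta>}"
      then show "R z f g = diag_resolvent z f g" using res diag_resolvent_eq_resolvent f by simp
    qed
  qed
  \<comment> \<open>At a point of \<open>Z\<close> off \<open>?Z0\<close> a whole ball avoids
    \<open>?Z0\<close>, and \<open>diag_resolvent\<close> on it would make the singularity
    removable.\<close>
  have sub: "Z \<subseteq> ?Z0"
  proof
    fix z assume z: "z \<in> Z"
    show "z \<in> ?Z0"
    proof (rule ccontr)
      assume "z \<notin> ?Z0"
      then obtain r where r: "r > 0" "ball z r \<subseteq> - ?Z0"
        using closed_eigvals open_contains_ball[of "- ?Z0"] by auto
      have "weakstar_holomorphic M diag_resolvent (ball z r)"
        using diag_resolvent_holomorphic holomorphic_on_subset[OF _ r(2)] r(2)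
        unfolding weakstar_holomorphic_def by blast
      moreover have "\<forall>\<zeta>\<in>ball z r - Z. \<forall>f\<in>X. diag_resolvent \<zeta> f = R \<zeta> f"
      proof (intro ballI)
        fix \<zeta> f assume "\<zeta> \<in> ball z r - Z" "f \<in> X"
        moreover from this have "\<zeta> \<in> - Z - ?Z0" using r(2) by blast
        ultimately show "diag_resolvent \<zeta> f = R \<zeta> f" using agree by simp
      qed
      ultimately have "removable_at M Z R z"
        unfolding removable_at_def using r(1) by blast
      then show False using sing[OF z] by blast
    qed
  qed
  \<comment> \<open>Otherwise \<open>R\<close> would be holomorphic on the open set
    \<open>- Z\<close>, which contains an eigenvalue, and would extend the resolvent across a
    pole.\<close>
  moreover have "?Z0 \<subseteq> Z"
  proof
    fix z assume z: "z \<in> ?Z0"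
    show "z \<in> Z"
    proof (rule ccontr)
      assume "z \<notin> Z"
      then obtain a where a: "lv a \<in> - Z"
        using eigval_in_open[of "- Z" z] Z(2) z by blast
      show False
      proof (rule diag_resolvent_no_extension[OF _ a _ countable_eigvals])
        show "open (- Z)" using Z(2) by blast
        show "(\<lambda>\<zeta>. R \<zeta> (ev a) (ev a)) holomorphic_on - Z"
          using R \<Phi>_in_X unfolding weakstar_holomorphic_def by blast
      qed (use agree \<Phi>_in_X in auto)
    qed
  qed
  ultimately show Z_eq: "Z = ?Z0" by blast
  show "R \<zeta> f = diag_resolvent \<zeta> f" if "\<zeta> \<in> - Z" "f \<in> X"
    using agree that Z_eq by blast
qed

section \<open>Riesz projections and generalized eigenvalues\<close>

text \<open>This keeps 0 out of the generalized eigenvalues although it belongs to the generalized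
  spectrum.\<close>

lemma zero_not_isolated: "\<not> 0 isolated_in insert 0 eigvals"
proof -
  have "\<exists>x\<in>insert 0 eigvals. x \<noteq> 0 \<and> dist x 0 < e" if e: "e > 0" for e
  proof -
    obtain n where "eigval Plus n \<in> ball 0 e" using eigval_near_0[OF e] by blast
    then show ?thesis
      using eigval_nonzero[of Plus n] unfolding eigvals_def by (intro bexI[of _ "eigval Plus n"]) auto
  qed
  then show ?thesis unfolding isolated_in_islimpt_iff islimpt_approachable by blast
qed

text \<open>On an eigenvector the resolvent has a single simple pole, so the contour integral is its
  residue times the winding number. The residue is the squared norm of the eigenvector, hence
  nonzero, and the image of the projection is nontrivial.\<close>

lemma riesz_projection_ev:
  assumes R: "\<And>\<zeta> f. \<zeta> \<in> - Z \<Longrightarrow> f \<in> X \<Longrightarrow> R \<zeta> f = diag_resolvent \<zeta> f" and Z: "Z = insert 0 eigvals"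
  shows "riesz_projection Z R (lv a) (ev a) (ev a) = L2_inner M (ev a) (ev a)"
proof -
  obtain r where r: "r > 0" "ball (lv a) r \<inter> Z \<subseteq> {lv a}"
    using eigvals_isolated[OF eigval_nonzero] unfolding Z by metis
  \<comment> \<open>The circle only shows that the choice of a curve is not vacuous. Of the curve
    actually chosen, nothing is used beyond \<open>encircles\<close>.\<close>
  have "encircles Z (lv a) (circlepath (lv a) (r / 2))"
    unfolding encircles_def
  proof (intro conjI ballI)
    show "path_image (circlepath (lv a) (r / 2)) \<subseteq> - Z"
    proof
      fix w assume "w \<in> path_image (circlepath (lv a) (r / 2))"
      then have "dist (lv a) w = r / 2" using r(1) by simp
      then have "w \<in> ball (lv a) r" "w \<noteq> lv a" using r(1) by auto
      then show "w \<in> - Z" using r(2) by blast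
    qed
    show "winding_number (circlepath (lv a) (r / 2)) (lv a) = 1"
      using r(1) by (intro winding_number_circlepath_centre) simp
    fix z assume "z \<in> Z - {lv a}"
    then have "z \<notin> ball (lv a) r" using r(2) by blast
    then have "z \<notin> cball (lv a) (r / 2)" using r(1) by auto
    then show "winding_number (circlepath (lv a) (r / 2)) z = 0"
      using r(1) by (intro winding_number_zero_outside[of _ "cball (lv a) (r / 2)"]) auto
  qed auto
  moreover define \<gamma> where "\<gamma> = (SOME \<gamma>. encircles Z (lv a) \<gamma>)"
  ultimately have "encircles Z (lv a) \<gamma>"
    using someI[where P = "encircles Z (lv a)"] by simp
  then have \<gamma>: "valid_path \<gamma>" "path_image \<gamma> \<subseteq> - Z" "winding_number \<gamma> (lv a) = 1"
    unfolding encircles_def by auto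
  have "lv a \<in> Z" unfolding Z eigvals_def by force
  then have notin: "lv a \<notin> path_image \<gamma>" using \<gamma>(2) by blast
  have "contour_integral \<gamma> (\<lambda>z. R z (ev a) (ev a)) =
      contour_integral \<gamma> (\<lambda>z. L2_inner M (ev a) (ev a) * (1 / (z - lv a)))"
  proof (rule contour_integral_eq)
    fix z assume "z \<in> path_image \<gamma>"
    then have "R z (ev a) = diag_resolvent z (ev a)" using R \<gamma>(2) \<Phi>_in_X by blast
    then show "R z (ev a) (ev a) = L2_inner M (ev a) (ev a) * (1 / (z - lv a))"
      by (simp add: diag_resolvent_ev \<Phi>_in_X)
  qed
  also have "\<dots> = L2_inner M (ev a) (ev a) * contour_integral \<gamma> (\<lambda>z. 1 / (z - lv a))"
    by (intro contour_integral_lmul contour_integrable_inversediff \<gamma>(1) notin)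
  finally show ?thesis
    using winding_number_valid_path[OF \<gamma>(1) notin] \<gamma>(3) \<Phi>_in_X
    unfolding riesz_projection_def \<gamma>_def[symmetric] by simp
qed

lemma generalized_eigenvalues:
  assumes "generalized_resolvent M Z R"
  shows "{z. generalized_eigenvalue Z R z} = eigvals"
proof (intro equalityI subsetI)
  note Z = generalized_spectrum_unique[OF assms] and R = generalized_resolvent_unique[OF assms]
  fix z assume "z \<in> {z. generalized_eigenvalue Z R z}"
  then have "z isolated_in insert 0 eigvals" unfolding generalized_eigenvalue_def Z by blast
  then show "z \<in> eigvals"
    using zero_not_isolated unfolding isolated_in_islimpt_iff by auto
next
  note Z = generalized_spectrum_unique[OF assms] and R = generalized_resolvent_unique[OF assms]
  fix z assume z: "z \<in> eigvals"
  then obtain a where a: "z = lv a" unfolding eigvals_def by auto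
  obtain r where "r > 0" "ball z r \<inter> Z \<subseteq> {z}"
    using eigvals_isolated[OF eigval_nonzero] unfolding Z a by metis
  then have "ball z r \<inter> Z = {z}" using z unfolding Z by auto
  then have "z isolated_in Z" unfolding isolated_in_def using z Z by blast
  moreover have "riesz_projection Z R z (ev a) (ev a) \<noteq> 0"
    using riesz_projection_ev[OF R Z] L2_inner_X_nonzero[OF \<Phi>_in_X \<Phi>_nonzero] unfolding a by simp
  then have "riesz_projection Z R z (ev a) \<noteq> (\<lambda>f\<in>X. 0)"
    using \<Phi>_in_X by auto
  ultimately show "z \<in> {z. generalized_eigenvalue Z R z}"
    unfolding generalized_eigenvalue_def generalized_eigenspace_def using \<Phi>_in_X by blast
qed

section \<open>The spectral decompositions\<close>

text \<open>The partial sums are constant from \<open>N = m\<close> on, because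
  \<open>\<Phi>' p n f = 0\<close> for \<open>n \<ge> m\<close>; convergence needs nothing about the
  topology except that the limit lies in \<open>X\<close>.\<close>

lemma limitin_branch_series:
  assumes f: "f \<in> test_span m"
  shows "limitin (X_topology M) (\<lambda>N \<omega>. \<Sum>n<N. k n * cnj (\<Phi>' p n f) * \<Phi> p n \<omega>)
    (\<lambda>\<omega>. \<Sum>n<m. k n * cnj (\<Phi>' p n f) * \<Phi> p n \<omega>) sequentially"
proof (rule limitin_eventually)
  show "(\<lambda>\<omega>. \<Sum>n<m. k n * cnj (\<Phi>' p n f) * \<Phi> p n \<omega>) \<in> topspace (X_topology M)"
    unfolding topspace_X_topology by (intro X_sum X_scale \<Phi>_in_X)
  show "\<forall>\<^sub>F N in sequentially. (\<lambda>\<omega>. \<Sum>n<N. k n * cnj (\<Phi>' p n f) * \<Phi> p n \<omega>) =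
      (\<lambda>\<omega>. \<Sum>n<m. k n * cnj (\<Phi>' p n f) * \<Phi> p n \<omega>)"
    using eventually_ge_at_top[of m]
  proof eventually_elim
    case (elim N)
    then show ?case
      using dv_eq_0[OF f, of "(p, _)"] by (intro ext sum_lessThan_trunc) auto
  qed
qed

lemma pf_X_expansion:
  assumes "f \<in> test_span n"
  shows "pf_X M f = (\<lambda>\<omega>. \<Sum>b\<in>idx n. (lv b * cnj (dv b f)) * ev b \<omega>)"
proof -
  have "f \<in> X" using assms test_span_subset_X by blast
  then show ?thesis using pf_X_eq_transfer transfer_eq_diagonal diagonal_eq[OF assms] by simp
qed

lemma spectral_decomposition:
  assumes "f \<in> X"
  shows "\<exists>F G.
    limitin (X_topology M)
      (\<lambda>N \<omega>. \<Sum>n<N. of_real (1 / golden ^ n) * cnj (\<Phi>' Plus n f) * \<Phi> Plus n \<omega>) F sequentially \<and>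
    limitin (X_topology M)
      (\<lambda>N \<omega>. \<Sum>n<N. of_real (1 / golden ^ (n + 2)) * cnj (\<Phi>' Minus n f) * \<Phi> Minus n \<omega>) G sequentially \<and>
    pf_X M f = (\<lambda>\<omega>. F \<omega> - G \<omega>)"
proof -
  obtain m where m: "f \<in> test_span m" using assms by (rule X_obtain)
  show ?thesis
  proof (intro exI conjI)
    show "pf_X M f = (\<lambda>\<omega>. (\<Sum>n<m. of_real (1 / golden ^ n) * cnj (\<Phi>' Plus n f) * \<Phi> Plus n \<omega>) -
        (\<Sum>n<m. of_real (1 / golden ^ (n + 2)) * cnj (\<Phi>' Minus n f) * \<Phi> Minus n \<omega>))"
      unfolding pf_X_expansion[OF m] sum_idx by (simp add: eigval_def sum_negf)
  qed (rule limitin_branch_series[OF m])+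
qed

text \<open>Here the partial sums need not stabilise as functionals, only on each test function
  separately; that is exactly convergence in the weak* topology, for arbitrary coefficients
  \<open>k\<close>. The second conjunct records the limit as a finite sum, so that it can be
  compared with \<open>koopman_dual\<close>.\<close>

lemma dual_branch_series:
  "\<exists>\<alpha>. limitin (X_dual_topology M) (\<lambda>N. \<lambda>f\<in>X. \<Sum>n<N. k n * \<Phi>' p n f) \<alpha> sequentially \<and>
    (\<forall>f m. f \<in> test_span m \<longrightarrow> \<alpha> f = (\<Sum>n<m. k n * \<Phi>' p n f))"
proof -
  let ?S = "\<lambda>N. \<lambda>f\<in>X. \<Sum>n<N. k n * \<Phi>' p n f"
  \<comment> \<open>For each \<open>f\<close> the sum runs over a finite set, which avoids choosing
    a degree bound in the definition.\<close>
  define \<alpha> where "\<alpha> = (\<lambda>f\<in>X. \<Sum>n | \<Phi>' p n f \<noteq> 0. k n * \<Phi>' p n f)"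
  have zero: "\<Phi>' p n f = 0" if "f \<in> test_span m" "n \<ge> m" for f m n
    using dv_eq_0[OF that(1), of "(p, n)"] that(2) by simp
  have \<alpha>: "\<alpha> f = (\<Sum>n<m. k n * \<Phi>' p n f)" if f: "f \<in> test_span m" for f m
  proof -
    have "{n. \<Phi>' p n f \<noteq> 0} \<subseteq> {..<m}"
      using zero[OF f] by (force simp: not_le[symmetric])
    then have "(\<Sum>n | \<Phi>' p n f \<noteq> 0. k n * \<Phi>' p n f) = (\<Sum>n<m. k n * \<Phi>' p n f)"
      by (intro sum.mono_neutral_left) auto
    then show ?thesis using f test_span_subset_X unfolding \<alpha>_def by auto
  qed
  have S: "antilinear_X (?S N)" for N
    unfolding antilinear_X_def
    by (auto simp: X_combination antilinear_XD[OF \<Phi>'_antilinear] sum_distrib_left sum.distrib[symmetric]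
        algebra_simps intro!: sum.cong)
  have "antilinear_X \<alpha>"
    unfolding antilinear_X_def
  proof (intro ballI allI)
    fix f g and a b :: complex assume fg: "f \<in> X" "g \<in> X"
    then obtain m where m: "f \<in> test_span m" "g \<in> test_span m" by (rule X_obtain2)
    then have m': "(\<lambda>\<omega>. a * f \<omega> + b * g \<omega>) \<in> test_span m" by (intro test_span_add test_span_scale)
    \<comment> \<open>With a common degree bound \<open>m\<close> for \<open>f\<close>,
      \<open>g\<close> and their combination, \<open>\<alpha>\<close> coincides on all three with
      one partial sum, whose anti-linearity it inherits.\<close>
    have "?S m (\<lambda>\<omega>. a * f \<omega> + b * g \<omega>) = cnj a * ?S m f + cnj b * ?S m g"
      by (rule antilinear_XD[OF S fg])
    then show "\<alpha> (\<lambda>\<omega>. a * f \<omega> + b * g \<omega>) = cnj a * \<alpha> f + cnj b * \<alpha> g"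
      unfolding \<alpha>[OF m'] \<alpha>[OF m(1)] \<alpha>[OF m(2)] using fg X_combination by simp
  qed
  then have "\<alpha> \<in> X_dual M" by (rule antilinear_in_X_dual) (simp add: \<alpha>_def)
  moreover have "?S N \<in> X_dual M" for N
    by (rule antilinear_in_X_dual[OF S]) simp
  moreover have "limitin (product_topology (\<lambda>_. euclidean) X) ?S \<alpha> sequentially"
    unfolding limitin_componentwise
  proof (intro conjI ballI)
    show "\<alpha> \<in> extensional X" by (simp add: \<alpha>_def)
    show "\<forall>\<^sub>F N in sequentially. ?S N \<in> topspace (product_topology (\<lambda>_. euclidean) X)"
      by (simp add: PiE_def)
    fix f assume f: "f \<in> X"
    then obtain m where m: "f \<in> test_span m" by (rule X_obtain)
    show "limitin euclidean (\<lambda>N. ?S N f) (\<alpha> f) sequentially"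
    proof (rule limitin_eventually)
      show "\<forall>\<^sub>F N in sequentially. ?S N f = \<alpha> f"
        using eventually_ge_at_top[of m]
      proof eventually_elim
        case (elim N)
        have "(\<Sum>n<N. k n * \<Phi>' p n f) = (\<Sum>n<m. k n * \<Phi>' p n f)"
          using zero[OF m] elim by (intro sum_lessThan_trunc) auto
        then show ?case using f \<alpha>[OF m] by simp
      qed
    qed simp
  qed
  ultimately show ?thesis
    using \<alpha> unfolding X_dual_topology_def limitin_subtopology by (intro exI[of _ \<alpha>]) auto
qed

lemma dual_spectral_decomposition:
  assumes \<mu>: "\<mu> \<in> X_dual M"
  shows "\<exists>\<alpha> \<beta>.
    limitin (X_dual_topology M)
      (\<lambda>N. \<lambda>f\<in>X. \<Sum>n<N. of_real (1 / golden ^ n) * \<mu> (\<Phi> Plus n) * \<Phi>' Plus n f) \<alpha> sequentially \<and>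
    limitin (X_dual_topology M)
      (\<lambda>N. \<lambda>f\<in>X. \<Sum>n<N. of_real (1 / golden ^ (n + 2)) * \<mu> (\<Phi> Minus n) * \<Phi>' Minus n f) \<beta> sequentially \<and>
    koopman_dual M \<mu> = (\<lambda>f\<in>X. \<alpha> f - \<beta> f)"
proof -
  obtain \<alpha> where \<alpha>:
    "limitin (X_dual_topology M)
      (\<lambda>N. \<lambda>f\<in>X. \<Sum>n<N. of_real (1 / golden ^ n) * \<mu> (\<Phi> Plus n) * \<Phi>' Plus n f) \<alpha> sequentially"
    "\<And>f m. f \<in> test_span m \<Longrightarrow> \<alpha> f = (\<Sum>n<m. of_real (1 / golden ^ n) * \<mu> (\<Phi> Plus n) * \<Phi>' Plus n f)"
    using dual_branch_series[of "\<lambda>n. of_real (1 / golden ^ n) * \<mu> (\<Phi> Plus n)" Plus] by blast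
  obtain \<beta> where \<beta>:
    "limitin (X_dual_topology M)
      (\<lambda>N. \<lambda>f\<in>X. \<Sum>n<N. of_real (1 / golden ^ (n + 2)) * \<mu> (\<Phi> Minus n) * \<Phi>' Minus n f) \<beta> sequentially"
    "\<And>f m. f \<in> test_span m \<Longrightarrow>
      \<beta> f = (\<Sum>n<m. of_real (1 / golden ^ (n + 2)) * \<mu> (\<Phi> Minus n) * \<Phi>' Minus n f)"
    using dual_branch_series[of "\<lambda>n. of_real (1 / golden ^ (n + 2)) * \<mu> (\<Phi> Minus n)" Minus] by blast
  have "koopman_dual M \<mu> = (\<lambda>f\<in>X. \<alpha> f - \<beta> f)"
    unfolding koopman_dual_def
  proof (rule restrict_ext)
    fix f assume "f \<in> X"
    then obtain m where m: "f \<in> test_span m" by (rule X_obtain)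
    \<comment> \<open>The eigenvalues are real, so conjugation leaves \<open>lv b\<close> fixed and
      undoes the conjugate of \<open>dv b f\<close>; the sign of the \<open>Minus\<close>
      eigenvalues becomes the subtraction of \<open>\<beta>\<close>.\<close>
    have "\<mu> (pf_X M f) = (\<Sum>b\<in>idx m. cnj (lv b * cnj (dv b f)) * \<mu> (ev b))"
      unfolding pf_X_expansion[OF m] by (rule antilinear_X_sum[OF X_dual_antilinear[OF \<mu>] \<Phi>_in_X])
    also have "\<dots> = \<alpha> f - \<beta> f"
      unfolding sum_idx \<alpha>(2)[OF m] \<beta>(2)[OF m] by (simp add: eigval_def sum_negf ac_simps)
    finally show "\<mu> (pf_X M f) = \<alpha> f - \<beta> f" .
  qed
  then show ?thesis using \<alpha>(1) \<beta>(1) by blast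
qed

end

theorem theorem3p19:
  fixes M :: "(nat \<Rightarrow> nat) measure"
    and \<Phi> :: "branch \<Rightarrow> nat \<Rightarrow> cfun"
    and \<Phi>' :: "branch \<Rightarrow> nat \<Rightarrow> cfun \<Rightarrow> complex"
  assumes "golden_markov_measure M"
    and "eigenvector_system M \<Phi>"
    and "dual_system M \<Phi> \<Phi>'"
  shows
    "(\<exists>Z R. generalized_resolvent M Z R) \<and>
     (\<forall>Z R. generalized_resolvent M Z R \<longrightarrow>
        {z. generalized_eigenvalue Z R z} =
          {of_real (1 / golden ^ n) | n. True} \<union> {- of_real (1 / golden ^ (n + 2)) | n. True}) \<and>
     (\<forall>f \<in> X. \<exists>F G.
        limitin (X_topology M)
          (\<lambda>N \<omega>. \<Sum>n<N. of_real (1 / golden ^ n) * cnj (\<Phi>' Plus n f) * \<Phi> Plus n \<omega>)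
          F sequentially \<and>
        limitin (X_topology M)
          (\<lambda>N \<omega>. \<Sum>n<N. of_real (1 / golden ^ (n + 2)) * cnj (\<Phi>' Minus n f) * \<Phi> Minus n \<omega>)
          G sequentially \<and>
        pf_X M f = (\<lambda>\<omega>. F \<omega> - G \<omega>)) \<and>
     (\<forall>\<mu> \<in> X_dual M. \<exists>\<alpha> \<beta>.
        limitin (X_dual_topology M)
          (\<lambda>N. \<lambda>f \<in> X. \<Sum>n<N. of_real (1 / golden ^ n) * \<mu> (\<Phi> Plus n) * \<Phi>' Plus n f)
          \<alpha> sequentially \<and>
        limitin (X_dual_topology M)
          (\<lambda>N. \<lambda>f \<in> X. \<Sum>n<N. of_real (1 / golden ^ (n + 2)) * \<mu> (\<Phi> Minus n) * \<Phi>' Minus n f)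
          \<beta> sequentially \<and>
        koopman_dual M \<mu> = (\<lambda>f \<in> X. \<alpha> f - \<beta> f))"
proof -
  interpret golden_eigensystem M \<Phi> \<Phi>'
    using assms by unfold_locales
  show ?thesis
    using diag_resolvent_generalized_resolvent generalized_eigenvalues[unfolded eigvals_eq]
      spectral_decomposition dual_spectral_decomposition
    by blast
qed

end
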